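(* For every choice of positive real parameters $\alpha,\beta,\gamma,A,B,C$, every solution $\{x_n\}_{n\ge -1}$ of the difference equation $$x_{n+1}=\frac{\alpha+\beta x_n+\gamma x_{n-1}}{A+Bx_n+Cx_{n-1}},\quad n=0,1,2,\dots,\qquad x_{-1},x_0\in[0,\infty),$$ converges to the (unique) positive equilibrium or to a prime period-two solution.
   Context: A solution is a sequence $\{x_n\}_{n\ge -1}$ with initial values in the indicated set satisfying the recursion. An equilibrium is a number $\overline{x}$ in the domain such that the constant sequence $x_n=\overline{x}$ is a solution; the equation above has a unique positive equilibrium. A prime period-two solution is a solution $\{p_n\}_{n\ge -1}$ with $p_{n+2}=p_n$ for all $n\ge -1$ and $p_{-1}\neq p_0$. A solution $\{x_n\}$ converges to a prime period-two solution $\{p_n\}$ if $x_n-p_n\to 0$ as $n\to\infty$ (equivalently, the even- and odd-indexed subsequences of $\{x_n\}$ converge to the two distinct values of $\{p_n\}$). *)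

theory Defs
  imports "HOL-Analysis.Analysis"
begin

text \<open>
  Second-order difference equations x_{n+1} = f (x_n, x_{n-1}), n = 0, 1, 2, ..., on [0, oo).
  Sequences indexed by n >= -1 are represented as functions on the natural numbers with the
  index shifted by one: \<open>x k\<close> stands for x_{k-1}. So \<open>x 0\<close> and \<open>x 1\<close> are the initial values
  x_{-1} and x_0. The first argument of \<open>f\<close> is the more recent term.
\<close>

definition rational_map ::
  "real \<Rightarrow> real \<Rightarrow> real \<Rightarrow> real \<Rightarrow> real \<Rightarrow> real \<Rightarrow> real \<Rightarrow> real \<Rightarrow> real" where
  "rational_map \<alpha> \<beta> \<gamma> A B C u v = (\<alpha> + \<beta> * u + \<gamma> * v) / (A + B * u + C * v)"

definition is_solution :: "(real \<Rightarrow> real \<Rightarrow> real) \<Rightarrow> (nat \<Rightarrow> real) \<Rightarrow> bool" where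
  "is_solution f x \<longleftrightarrow>
     x 0 \<in> {0..} \<and> x 1 \<in> {0..} \<and> (\<forall>n. x (n + 2) = f (x (n + 1)) (x n))"

definition is_equilibrium :: "(real \<Rightarrow> real \<Rightarrow> real) \<Rightarrow> real \<Rightarrow> bool" where
  "is_equilibrium f e \<longleftrightarrow> e \<in> {0..} \<and> is_solution f (\<lambda>n. e)"

definition is_prime_period_two :: "(real \<Rightarrow> real \<Rightarrow> real) \<Rightarrow> (nat \<Rightarrow> real) \<Rightarrow> bool" where
  "is_prime_period_two f p \<longleftrightarrow> is_solution f p \<and> (\<forall>n. p (n + 2) = p n) \<and> p 0 \<noteq> p 1"

end

theory Submission
  imports Defs
begin

text \<open>
  Let \<open>I\<close> and \<open>S\<close> be the limits inferior and superior of a solution, which is bounded. By compactness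
  \<open>S = f u v\<close> and \<open>I = f u' v'\<close> for some arguments in \<open>{I..S}\<close> (lemma \<open>limit_point_is_image\<close>). The map \<open>f\<close> is a
  Moebius map in each variable, and the direction in which it is monotone in one variable depends
  only on the value of the other one (\<open>slope\<^sub>1\<close>, \<open>slope\<^sub>2\<close>). This moves the arguments to
  the corners of the square with side \<open>{I..S}\<close> and yields inequalities such as \<open>S \<le> f I S\<close> and \<open>f I I \<le> I\<close>. If
  \<open>I < S\<close>, subtracting these inequalities refutes every configuration except two, in which \<open>f\<close> is
  monotone in opposite directions on the whole square.

  If \<open>f\<close> decreases in the recent and increases in the older argument, then the even- and odd-indexed terms
  are eventually monotone, so they converge, and their limits form an equilibrium or a two-cycle
  (\<open>converges_if_eventually_decreasing_increasing\<close>).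

  If \<open>f\<close> increases in the recent and decreases in the older argument, order arguments fail: the system
  \<open>S = f S I\<close>, \<open>I = f I S\<close> can have solutions with \<open>I < S\<close>. This regime comes arbitrarily close to
  Lyness' equation \<open>x\<^sub>n\<^sub>+\<^sub>1 = (\<alpha> + \<beta> x\<^sub>n) / x\<^sub>n\<^sub>-\<^sub>1\<close>, all of whose positive solutions lie on closed invariant curves, so a
  Lyapunov function has to deform the invariant of that equation. It is found as follows. For consecutive terms
  \<open>y, x, z\<close> the recursion splits into a part symmetric in \<open>y\<close> and \<open>z\<close> and a multiple of \<open>z - y\<close>. The symmetric
  part alone defines an integrable (QRT) map, and it has an invariant that is a quotient of two symmetric
  biquadratics. Along the recursion itself this quotient changes by \<open>- (z - y)\<^sup>2\<close> times a factor
  (\<open>lyapunov_step\<close>), which the inequalities satisfied by \<open>I\<close> and \<open>S\<close> make positive (\<open>dissipation_factor_pos\<close>,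
  \<open>lyap_den_pos\<close>). Hence \<open>x (n + 2) - x n\<close> tends to 0, and since this regime has no two-cycles the
  solution tends to the equilibrium.
\<close>

section \<open>Limit points of bounded sequences\<close>

lemma bounded_seq_limsup:
  fixes x :: "nat \<Rightarrow> real"
  assumes "bounded (range x)"
  obtains S r where "\<And>c. c > S \<Longrightarrow> \<forall>\<^sub>F n in sequentially. x n < c"
    and "strict_mono (r :: nat \<Rightarrow> nat)" and "(\<lambda>k. x (r k)) \<longlonglongrightarrow> S"
proof -
  obtain M where M: "\<And>n. \<bar>x n\<bar> \<le> M"
    using assms by (auto simp: bounded_iff)
  define L where "L = limsup (\<lambda>n. ereal (x n))"
  have "L \<le> ereal M" unfolding L_def
    by (rule Limsup_bounded) (use M in \<open>auto simp: abs_le_iff\<close>)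
  moreover have "ereal (- M) \<le> L" unfolding L_def
    by (rule le_Limsup) (use M in \<open>auto simp: abs_le_iff minus_le_iff\<close>)
  ultimately obtain S where S: "L = ereal S" by (cases L) auto
  obtain r where r: "strict_mono r" "((\<lambda>n. ereal (x n)) \<circ> r) \<longlonglongrightarrow> L"
    unfolding L_def using limsup_subseq_lim by blast
  have "(\<lambda>k. x (r k)) \<longlonglongrightarrow> S" using r(2) by (simp add: S o_def)
  moreover have "\<forall>\<^sub>F n in sequentially. x n < c" if "c > S" for c
  proof -
    have "limsup (\<lambda>n. ereal (x n)) < ereal c" using that S L_def by simp
    from Limsup_lessD[OF this] show ?thesis by simp
  qed
  ultimately show ?thesis using that r(1) by blast
qed

lemma bounded_seq_liminf:
  fixes x :: "nat \<Rightarrow> real"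
  assumes "bounded (range x)"
  obtains I r where "\<And>c. c < I \<Longrightarrow> \<forall>\<^sub>F n in sequentially. c < x n"
    and "strict_mono (r :: nat \<Rightarrow> nat)" and "(\<lambda>k. x (r k)) \<longlonglongrightarrow> I"
proof -
  have "bounded (range (\<lambda>n. - x n))"
    using assms by (auto simp: bounded_iff)
  then obtain S r where S: "\<And>c. c > S \<Longrightarrow> \<forall>\<^sub>F n in sequentially. - x n < c"
    "strict_mono (r :: nat \<Rightarrow> nat)" "(\<lambda>k. - x (r k)) \<longlonglongrightarrow> S"
    by (rule bounded_seq_limsup) blast
  have "(\<lambda>k. x (r k)) \<longlonglongrightarrow> - S" using tendsto_minus[OF S(3)] by simp
  moreover have "\<forall>\<^sub>F n in sequentially. c < x n" if "c < - S" for c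
    using S(1)[of "- c"] that by simp
  ultimately show ?thesis using that S(2) by blast
qed

lemma eventual_bounds_of_subseq_limit:
  fixes x :: "nat \<Rightarrow> real"
  assumes lo: "\<And>c. c < I \<Longrightarrow> \<forall>\<^sub>F n in sequentially. c < x n"
    and hi: "\<And>c. c > S \<Longrightarrow> \<forall>\<^sub>F n in sequentially. x n < c"
    and s: "filterlim s sequentially sequentially"
    and l: "(\<lambda>k. x (s k)) \<longlonglongrightarrow> l"
  shows "I \<le> l" "l \<le> S"
proof -
  have "c \<le> l" if "c < I" for c
  proof (rule tendsto_lowerbound[OF l])
    show "\<forall>\<^sub>F k in sequentially. c \<le> x (s k)"
      using filterlim_iff[THEN iffD1, OF s, rule_format, OF lo[OF that]]
      by (rule eventually_mono) simp
  qed simp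
  then show "I \<le> l" by (rule dense_le)
  have "l \<le> c" if "S < c" for c
  proof (rule tendsto_upperbound[OF l])
    show "\<forall>\<^sub>F k in sequentially. x (s k) \<le> c"
      using filterlim_iff[THEN iffD1, OF s, rule_format, OF hi[OF that]]
      by (rule eventually_mono) simp
  qed simp
  then show "l \<le> S" by (rule dense_ge)
qed

text \<open>
  A limit point of a bounded solution has a past that consists of limit points: after passing
  to a further subsequence, the two preceding terms converge as well.
\<close>

lemma limit_point_is_image:
  fixes x :: "nat \<Rightarrow> real"
  assumes bdd: "bounded (range x)"
    and nonneg: "\<And>n. 0 \<le> x n"
    and rec: "\<And>n. x (n + 2) = f (x (n + 1)) (x n)"
    and cont: "continuous_on ({0..} \<times> {0..}) (\<lambda>(u, v). f u v)"
    and r: "strict_mono (r :: nat \<Rightarrow> nat)" and l: "(\<lambda>k. x (r k)) \<longlonglongrightarrow> l"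
    and lo: "\<And>c. c < I \<Longrightarrow> \<forall>\<^sub>F n in sequentially. c < x n"
    and hi: "\<And>c. c > S \<Longrightarrow> \<forall>\<^sub>F n in sequentially. x n < c"
  obtains u v where "u \<in> {I..S}" "v \<in> {I..S}" "l = f u v"
proof -
  have rge: "k \<le> r k" for k using r by (rule seq_suble)
  define q where "q = (\<lambda>k. r (k + 2) - 2)"
  have q2: "q k + 2 = r (k + 2)" for k using rge[of "k + 2"] by (simp add: q_def)
  have qge: "k \<le> q k" for k using rge[of "k + 2"] by (simp add: q_def)
  define w where "w = (\<lambda>k. (x (q k + 1), x (q k)))"
  obtain M where M: "\<And>n. \<bar>x n\<bar> \<le> M" using bdd by (auto simp: bounded_iff)
  have "range w \<subseteq> {-M..M} \<times> {-M..M}"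
    using M by (auto simp: w_def abs_le_iff minus_le_iff)
  then have "bounded (range w)"
    by (rule bounded_subset[rotated]) (auto intro: bounded_Times)
  then obtain p s where s: "strict_mono (s :: nat \<Rightarrow> nat)" and p: "(w \<circ> s) \<longlonglongrightarrow> p"
    using bounded_imp_convergent_subsequence by blast
  obtain u v where uv: "p = (u, v)" by (cases p)
  have u: "(\<lambda>k. x (q (s k) + 1)) \<longlonglongrightarrow> u"
    using tendsto_fst[OF p] by (simp add: uv w_def o_def)
  have v: "(\<lambda>k. x (q (s k))) \<longlonglongrightarrow> v"
    using tendsto_snd[OF p] by (simp add: uv w_def o_def)
  have sge: "k \<le> s k" for k using s by (rule seq_suble)
  have fl: "filterlim (\<lambda>k. q (s k)) sequentially sequentially"
    by (rule filterlim_at_top_mono[OF filterlim_ident])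
      (use order_trans[OF sge qge] in \<open>auto intro!: always_eventually\<close>)
  have fl1: "filterlim (\<lambda>k. q (s k) + 1) sequentially sequentially"
    by (rule filterlim_at_top_mono[OF fl]) auto
  have ui: "u \<in> {I..S}" using eventual_bounds_of_subseq_limit[OF lo hi fl1 u] by auto
  have vi: "v \<in> {I..S}" using eventual_bounds_of_subseq_limit[OF lo hi fl v] by auto
  have u0: "0 \<le> u" by (rule LIMSEQ_le_const[OF u]) (use nonneg in auto)
  have v0: "0 \<le> v" by (rule LIMSEQ_le_const[OF v]) (use nonneg in auto)
  have "(\<lambda>k. (\<lambda>(u, v). f u v) ((w \<circ> s) k)) \<longlonglongrightarrow> (\<lambda>(u, v). f u v) p"
    by (rule continuous_on_tendsto_compose[OF cont p])
      (use u0 v0 nonneg in \<open>auto simp: uv w_def\<close>)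
  then have "(\<lambda>k. x (q (s k) + 2)) \<longlonglongrightarrow> f u v"
    using rec by (simp add: uv w_def o_def)
  then have 1: "(\<lambda>k. x (r (s k + 2))) \<longlonglongrightarrow> f u v" by (simp only: q2)
  have "filterlim (\<lambda>k. s k + 2) sequentially sequentially"
    by (rule filterlim_at_top_mono[OF filterlim_ident])
      (use sge in \<open>auto intro!: always_eventually simp: le_SucI\<close>)
  from filterlim_compose[OF l this] have "(\<lambda>k. x (r (s k + 2))) \<longlonglongrightarrow> l" .
  with 1 have "l = f u v" by (rule LIMSEQ_unique[rotated])
  with ui vi show ?thesis by (rule that)
qed

lemma tendsto_even_odd:
  fixes y :: "nat \<Rightarrow> 'a :: topological_space"
  assumes even: "(\<lambda>k. y (2 * k)) \<longlonglongrightarrow> l" and odd: "(\<lambda>k. y (2 * k + 1)) \<longlonglongrightarrow> l"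
  shows "y \<longlonglongrightarrow> l"
proof (rule topological_tendstoI)
  fix U assume U: "open U" "l \<in> U"
  obtain K K' where K: "\<And>k. k \<ge> K \<Longrightarrow> y (2 * k) \<in> U" "\<And>k. k \<ge> K' \<Longrightarrow> y (2 * k + 1) \<in> U"
    using topological_tendstoD[OF even U] topological_tendstoD[OF odd U]
    unfolding eventually_sequentially by blast
  have "y n \<in> U" if "n \<ge> 2 * K + 2 * K' + 1" for n
    using that K(1)[of "n div 2"] K(2)[of "n div 2"] by (cases "even n") auto
  then show "\<forall>\<^sub>F n in sequentially. y n \<in> U"
    unfolding eventually_sequentially by blast
qed

section \<open>Sequences with alternating increments\<close>

text \<open>
  Two adjacent increments of opposite weak sign start a pattern that reproduces itself forever.
  If there are none, then all increments have the same strict sign.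
\<close>

lemma parity_sign_pattern:
  fixes \<delta> :: "nat \<Rightarrow> real"
  assumes up: "\<And>n. \<delta> n \<ge> 0 \<Longrightarrow> \<delta> (n + 1) \<le> 0 \<Longrightarrow> \<delta> (n + 2) \<ge> 0"
    and down: "\<And>n. \<delta> n \<le> 0 \<Longrightarrow> \<delta> (n + 1) \<ge> 0 \<Longrightarrow> \<delta> (n + 2) \<le> 0"
  obtains N where
    "(\<forall>k. \<delta> (N + 2 * k) \<ge> 0) \<or> (\<forall>k. \<delta> (N + 2 * k) \<le> 0)"
    "(\<forall>k. \<delta> (N + 1 + 2 * k) \<ge> 0) \<or> (\<forall>k. \<delta> (N + 1 + 2 * k) \<le> 0)"
proof (cases "\<exists>n. (\<delta> n \<ge> 0 \<and> \<delta> (n + 1) \<le> 0) \<or> (\<delta> n \<le> 0 \<and> \<delta> (n + 1) \<ge> 0)")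
  case True
  then obtain N where N: "(\<delta> N \<ge> 0 \<and> \<delta> (N + 1) \<le> 0) \<or> (\<delta> N \<le> 0 \<and> \<delta> (N + 1) \<ge> 0)" ..
  then show ?thesis
  proof
    assume N: "\<delta> N \<ge> 0 \<and> \<delta> (N + 1) \<le> 0"
    have "\<delta> (N + 2 * k) \<ge> 0 \<and> \<delta> (N + 1 + 2 * k) \<le> 0" for k
    proof (induction k)
      case (Suc k)
      with up[of "N + 2 * k"] down[of "N + 1 + 2 * k"] show ?case
        by (simp add: algebra_simps)
    qed (use N in simp)
    then show ?thesis using that[of N] by blast
  next
    assume N: "\<delta> N \<le> 0 \<and> \<delta> (N + 1) \<ge> 0"
    have "\<delta> (N + 2 * k) \<le> 0 \<and> \<delta> (N + 1 + 2 * k) \<ge> 0" for k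
    proof (induction k)
      case (Suc k)
      with down[of "N + 2 * k"] up[of "N + 1 + 2 * k"] show ?case
        by (simp add: algebra_simps)
    qed (use N in simp)
    then show ?thesis using that[of N] by blast
  qed
next
  case False
  then have alt: "(\<delta> n > 0 \<and> \<delta> (n + 1) > 0) \<or> (\<delta> n < 0 \<and> \<delta> (n + 1) < 0)" for n
    by (meson linorder_not_le order_le_less)
  have "(\<delta> 0 > 0 \<longrightarrow> \<delta> n > 0) \<and> (\<delta> 0 < 0 \<longrightarrow> \<delta> n < 0)" for n
  proof (induction n)
    case (Suc n)
    with alt[of n] show ?case by auto
  qed simp
  then show ?thesis using alt[of 0] that[of 0] by (meson less_imp_le)
qed

text \<open>
  The hypotheses are what a recursion gives that decreases in the more recent argument and increases
  in the older one. They make both parity subsequences eventually monotone.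
\<close>

lemma bounded_alternating_increments_converge:
  fixes x :: "nat \<Rightarrow> real"
  assumes bdd: "bounded (range x)"
    and up: "\<And>n. x n \<le> x (n + 2) \<Longrightarrow> x (n + 3) \<le> x (n + 1) \<Longrightarrow> x (n + 2) \<le> x (n + 4)"
    and down: "\<And>n. x (n + 2) \<le> x n \<Longrightarrow> x (n + 1) \<le> x (n + 3) \<Longrightarrow> x (n + 4) \<le> x (n + 2)"
  obtains N l l' where "(\<lambda>k. x (N + 2 * k)) \<longlonglongrightarrow> l" "(\<lambda>k. x (N + 1 + 2 * k)) \<longlonglongrightarrow> l'"
proof -
  have conv: "convergent (\<lambda>k. x (M + 2 * k))"
    if "(\<forall>k. x (M + 2 * k + 2) - x (M + 2 * k) \<ge> 0) \<or>
        (\<forall>k. x (M + 2 * k + 2) - x (M + 2 * k) \<le> 0)" for M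
  proof (rule Bseq_monoseq_convergent)
    show "Bseq (\<lambda>k. x (M + 2 * k))"
      using bdd by (auto simp: Bseq_eq_bounded intro: bounded_subset)
    show "monoseq (\<lambda>k. x (M + 2 * k))"
      using that by (auto simp: monoseq_Suc)
  qed
  obtain N where N:
    "(\<forall>k. x (N + 2 * k + 2) - x (N + 2 * k) \<ge> 0) \<or> (\<forall>k. x (N + 2 * k + 2) - x (N + 2 * k) \<le> 0)"
    "(\<forall>k. x (N + 1 + 2 * k + 2) - x (N + 1 + 2 * k) \<ge> 0) \<or>
     (\<forall>k. x (N + 1 + 2 * k + 2) - x (N + 1 + 2 * k) \<le> 0)"
  proof (rule parity_sign_pattern[of "\<lambda>n. x (n + 2) - x n"])
    fix n
    show "x (n + 2 + 2) - x (n + 2) \<ge> 0"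
      if "x (n + 2) - x n \<ge> 0" "x (n + 1 + 2) - x (n + 1) \<le> 0"
      using up[of n] that by (simp add: algebra_simps eval_nat_numeral)
    show "x (n + 2 + 2) - x (n + 2) \<le> 0"
      if "x (n + 2) - x n \<le> 0" "x (n + 1 + 2) - x (n + 1) \<ge> 0"
      using down[of n] that by (simp add: algebra_simps eval_nat_numeral)
  qed blast
  show ?thesis
    using conv[OF N(1)] conv[OF N(2)] that unfolding convergent_def by blast
qed


section \<open>Monotonicity of the rational map\<close>

locale rational_recursion =
  fixes \<alpha> \<beta> \<gamma> A B C :: real
  assumes \<alpha>_pos: "\<alpha> > 0" and \<beta>_pos: "\<beta> > 0" and \<gamma>_pos: "\<gamma> > 0"
    and A_pos: "A > 0" and B_pos: "B > 0" and C_pos: "C > 0"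
begin

abbreviation f where "f \<equiv> rational_map \<alpha> \<beta> \<gamma> A B C"

lemmas param_pos = \<alpha>_pos \<beta>_pos \<gamma>_pos A_pos B_pos C_pos

lemma denom_pos: "A + B * u + C * v > 0" if "u \<ge> 0" "v \<ge> 0"
  using that param_pos by (simp add: add_pos_nonneg)

lemma f_pos: "f u v > 0" if "u \<ge> 0" "v \<ge> 0"
  using that param_pos denom_pos[OF that] by (simp add: rational_map_def add_pos_nonneg)

lemma eq_f_iff: "z = f u v \<longleftrightarrow> z * (A + B * u + C * v) = \<alpha> + \<beta> * u + \<gamma> * v"
  if "u \<ge> 0" "v \<ge> 0"
  using denom_pos[OF that] by (simp add: rational_map_def eq_divide_eq)

lemma le_f_iff: "z \<le> f u v \<longleftrightarrow> z * (A + B * u + C * v) \<le> \<alpha> + \<beta> * u + \<gamma> * v"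
  if "u \<ge> 0" "v \<ge> 0"
  using denom_pos[OF that] by (simp add: rational_map_def pos_le_divide_eq)

lemma f_le_iff: "f u v \<le> z \<longleftrightarrow> \<alpha> + \<beta> * u + \<gamma> * v \<le> z * (A + B * u + C * v)"
  if "u \<ge> 0" "v \<ge> 0"
  using denom_pos[OF that] by (simp add: rational_map_def pos_divide_le_eq)

text \<open>
  Up to the positive factor \<open>(A + B * u + C * v)\<^sup>2\<close>, these are the partial derivatives of \<open>f u v\<close>.
  Each is affine and depends only on the other variable, because \<open>f\<close> is a Moebius map
  in each variable separately. So the direction in which \<open>f\<close> is monotone in one variable is
  constant along that variable.
\<close>

definition slope\<^sub>1 where "slope\<^sub>1 v = (\<beta> * A - B * \<alpha>) - (\<gamma> * B - \<beta> * C) * v"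
definition slope\<^sub>2 where "slope\<^sub>2 u = (\<gamma> * A - C * \<alpha>) + (\<gamma> * B - \<beta> * C) * u"

lemma f_mono\<^sub>1: "f u v \<le> f u' v"
  if "(u' - u) * slope\<^sub>1 v \<ge> 0" "u \<ge> 0" "u' \<ge> 0" "v \<ge> 0"
proof -
  have "(\<alpha> + \<beta> * u' + \<gamma> * v) * (A + B * u + C * v)
      - (\<alpha> + \<beta> * u + \<gamma> * v) * (A + B * u' + C * v) = (u' - u) * slope\<^sub>1 v"
    by (simp add: slope\<^sub>1_def algebra_simps)
  with that denom_pos[of u v] denom_pos[of u' v] show ?thesis
    by (simp add: rational_map_def divide_le_eq le_divide_eq mult.commute field_simps)
qed

lemma f_mono\<^sub>2: "f u v \<le> f u v'"
  if "(v' - v) * slope\<^sub>2 u \<ge> 0" "u \<ge> 0" "v \<ge> 0" "v' \<ge> 0"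
proof -
  have "(\<alpha> + \<beta> * u + \<gamma> * v') * (A + B * u + C * v)
      - (\<alpha> + \<beta> * u + \<gamma> * v) * (A + B * u + C * v') = (v' - v) * slope\<^sub>2 u"
    by (simp add: slope\<^sub>2_def algebra_simps)
  with that denom_pos[of u v] denom_pos[of u v'] show ?thesis
    by (simp add: rational_map_def divide_le_eq le_divide_eq mult.commute field_simps)
qed

lemma continuous_on_f: "continuous_on ({0..} \<times> {0..}) (\<lambda>(u, v). f u v)"
  unfolding rational_map_def case_prod_beta
  by (intro continuous_intros) (use denom_pos in \<open>force\<close>)

lemma f_bounded: "f u v \<le> \<alpha> / A + \<beta> / B + \<gamma> / C" if "u \<ge> 0" "v \<ge> 0"
proof -
  have "\<alpha> = \<alpha> / A * A" "\<beta> * u = \<beta> / B * (B * u)" "\<gamma> * v = \<gamma> / C * (C * v)"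
    using param_pos by auto
  moreover have "\<alpha> / A * A + \<beta> / B * (B * u) + \<gamma> / C * (C * v)
      \<le> (\<alpha> / A + \<beta> / B + \<gamma> / C) * (A + B * u + C * v)"
    using that param_pos by (simp add: algebra_simps add_nonneg_nonneg)
  ultimately show ?thesis using that by (simp add: f_le_iff)
qed

end

section \<open>Equilibria\<close>

context rational_recursion
begin

text \<open>
  The difference of the two inequalities, divided by \<open>S - I\<close>, bounds \<open>\<beta> + \<gamma>\<close> from below by
  \<open>A + (B + C) * (S + I)\<close>, whereas the inequality at \<open>I\<close> forces \<open>(\<beta> + \<gamma>) * I < (A + (B + C) * I) * I\<close>.
\<close>

lemma no_two_fixed_points:
  assumes "0 \<le> I" "I < S" "S \<le> f S S" "f I I \<le> I"
  shows False
proof -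
  from assms have 1: "S * (A + B * S + C * S) \<le> \<alpha> + \<beta> * S + \<gamma> * S"
    and 2: "\<alpha> + \<beta> * I + \<gamma> * I \<le> I * (A + B * I + C * I)"
    by (simp_all add: le_f_iff f_le_iff)
  have "(S - I) * (A + (B + C) * (S + I) - \<beta> - \<gamma>) \<le> 0"
    using 1 2 by (simp add: algebra_simps)
  then have "A + (B + C) * (S + I) - \<beta> - \<gamma> \<le> 0"
    using assms by (simp add: mult_le_0_iff)
  then have "I * (A + (B + C) * (S + I) - \<beta> - \<gamma>) \<le> 0"
    using assms by (simp add: mult_le_0_iff)
  moreover have "0 \<le> (B + C) * (S * I)" using assms param_pos by simp
  ultimately show False using 2 \<alpha>_pos by (simp add: algebra_simps)
qed

lemma is_equilibrium_iff: "is_equilibrium f e \<longleftrightarrow> e \<ge> 0 \<and> e = f e e"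
  by (auto simp: is_equilibrium_def is_solution_def)

lemma equilibrium_unique: "e = e'" if "is_equilibrium f e" "is_equilibrium f e'"
  using no_two_fixed_points[of e e'] no_two_fixed_points[of e' e] that
  by (force simp: is_equilibrium_iff not_less dest: order_antisym)

lemma equilibrium_exists: "\<exists>e. e > 0 \<and> is_equilibrium f e"
proof -
  define m where "m = A - \<beta> - \<gamma>"
  define d where "d = sqrt (m\<^sup>2 + 4 * (B + C) * \<alpha>)"
  define e where "e = (d - m) / (2 * (B + C))"
  have BC: "B + C > 0" using param_pos by simp
  have pos: "0 < 4 * (B + C) * \<alpha>" using BC param_pos by simp
  have d2: "d * d = m * m + 4 * (B + C) * \<alpha>"
    using pos unfolding d_def power2_eq_square[symmetric] by (subst real_sqrt_pow2) auto
  have "\<bar>m\<bar> < d" unfolding d_def using pos by (intro real_less_rsqrt) simp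
  then have e: "e > 0" using BC by (simp add: e_def)
  have "2 * (B + C) * e = d - m" using BC by (simp add: e_def)
  then have "(2 * (B + C) * e + m) * (2 * (B + C) * e + m) = m * m + 4 * (B + C) * \<alpha>"
    using d2 by simp
  then have "(B + C) * (e * (A + B * e + C * e)) = (B + C) * (\<alpha> + \<beta> * e + \<gamma> * e)"
    by (simp add: m_def algebra_simps)
  then have "e = f e e" using BC e by (subst eq_f_iff) auto
  with e show ?thesis by (auto simp: is_equilibrium_iff)
qed

lemma tendsto_equilibrium:
  assumes e: "is_equilibrium f e" "e > 0" and nonneg: "\<And>n. 0 \<le> x n"
    and defect: "(\<lambda>n. x n * (A + B * x n + C * x n) - (\<alpha> + \<beta> * x n + \<gamma> * x n)) \<longlonglongrightarrow> 0"
  shows "x \<longlonglongrightarrow> e"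
proof -
  have e_eq: "e * (A + B * e + C * e) = \<alpha> + \<beta> * e + \<gamma> * e"
    using e eq_f_iff[of e e e] by (simp add: is_equilibrium_iff)
  \<comment> \<open>By Vieta, the second root of the equilibrium polynomial is \<open>- \<alpha> / ((B + C) * e)\<close>. It is
    negative, so the second factor stays away from zero on nonnegative arguments.\<close>
  have factor: "e * (t * (A + B * t + C * t) - (\<alpha> + \<beta> * t + \<gamma> * t))
      = (t - e) * ((B + C) * e * t + \<alpha>)" for t
  proof -
    have "e * (t * (A + B * t + C * t) - (\<alpha> + \<beta> * t + \<gamma> * t)) - (t - e) * ((B + C) * e * t + \<alpha>)
      = t * (e * (A + B * e + C * e) - (\<alpha> + \<beta> * e + \<gamma> * e))"
      by (simp add: algebra_simps)
    then show ?thesis using e_eq by simp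
  qed
  have "(\<lambda>n. x n - e) \<longlonglongrightarrow> 0"
  proof (rule Lim_null_comparison)
    have "(\<lambda>n. e / \<alpha> * \<bar>x n * (A + B * x n + C * x n) - (\<alpha> + \<beta> * x n + \<gamma> * x n)\<bar>)
        \<longlonglongrightarrow> e / \<alpha> * \<bar>0\<bar>"
      by (intro tendsto_intros defect)
    then show "(\<lambda>n. e / \<alpha> * \<bar>x n * (A + B * x n + C * x n) - (\<alpha> + \<beta> * x n + \<gamma> * x n)\<bar>)
        \<longlonglongrightarrow> 0" by simp
    have "norm (x n - e) \<le> e / \<alpha> * \<bar>x n * (A + B * x n + C * x n) - (\<alpha> + \<beta> * x n + \<gamma> * x n)\<bar>" for n
    proof -
      have "\<alpha> \<le> (B + C) * e * x n + \<alpha>" using nonneg[of n] e param_pos by simp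
      then have "\<bar>x n - e\<bar> * \<alpha> \<le> \<bar>x n - e\<bar> * \<bar>(B + C) * e * x n + \<alpha>\<bar>"
        by (intro mult_left_mono) auto
      also have "\<dots> = e * \<bar>x n * (A + B * x n + C * x n) - (\<alpha> + \<beta> * x n + \<gamma> * x n)\<bar>"
        using arg_cong[OF factor[of "x n"], of abs] e by (simp add: abs_mult)
      finally show ?thesis using \<alpha>_pos by (simp add: field_simps)
    qed
    then show "\<forall>\<^sub>F n in sequentially. norm (x n - e)
        \<le> e / \<alpha> * \<bar>x n * (A + B * x n + C * x n) - (\<alpha> + \<beta> * x n + \<gamma> * x n)\<bar>" by simp
  qed
  then show ?thesis by (simp add: LIM_zero_iff)
qed

definition tends_to_equilibrium_or_two_cycle where
  "tends_to_equilibrium_or_two_cycle x \<longleftrightarrow>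
     (\<exists>e. e > 0 \<and> is_equilibrium f e \<and> x \<longlonglongrightarrow> e) \<or>
     (\<exists>p. is_prime_period_two f p \<and> (\<lambda>n. x n - p n) \<longlonglongrightarrow> 0)"

end


section \<open>Solutions with convergent parity subsequences\<close>

locale solution = rational_recursion +
  fixes x :: "nat \<Rightarrow> real"
  assumes solution: "is_solution f x"
begin

lemma nonneg: "0 \<le> x n"
proof -
  have "0 \<le> x n \<and> 0 \<le> x (n + 1)"
  proof (induction n)
    case (Suc n)
    then show ?case
      using solution f_pos[of "x (n + 1)" "x n"] by (simp add: is_solution_def)
  qed (use solution in \<open>simp add: is_solution_def\<close>)
  then show ?thesis ..
qed

lemma rec: "x (n + 2) = f (x (n + 1)) (x n)"
  using solution by (simp add: is_solution_def)

lemma bounded: "bounded (range x)"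
proof -
  define M where "M = max (max (x 0) (x 1)) (\<alpha> / A + \<beta> / B + \<gamma> / C)"
  have "x n \<le> M" for n
  proof (cases "n < 2")
    case True
    then show ?thesis by (auto simp: M_def less_2_cases_iff)
  next
    case False
    then obtain k where "n = k + 2" by (metis add.commute le_iff_add not_less)
    then show ?thesis
      using f_bounded[OF nonneg nonneg, of "k + 1" k] rec[of k] by (simp add: M_def)
  qed
  then show ?thesis using nonneg by (intro boundedI[of _ M]) auto
qed

lemma converges_if_parity_subsequences_converge:
  assumes even: "(\<lambda>k. x (N + 2 * k)) \<longlonglongrightarrow> l" and odd: "(\<lambda>k. x (N + 1 + 2 * k)) \<longlonglongrightarrow> l'"
  shows "tends_to_equilibrium_or_two_cycle x"
proof -
  have l0: "0 \<le> l" "0 \<le> l'"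
    using LIMSEQ_le_const[OF even, of 0] LIMSEQ_le_const[OF odd, of 0] nonneg by auto
  have f_lim: "(\<lambda>k. f (a k) (b k)) \<longlonglongrightarrow> f u v"
    if "a \<longlonglongrightarrow> u" "b \<longlonglongrightarrow> v" "u \<ge> 0" "v \<ge> 0" "\<And>k. a k \<ge> 0" "\<And>k. b k \<ge> 0" for a b u v
    unfolding rational_map_def
    by (intro tendsto_intros that) (use denom_pos[OF that(3,4)] in simp)
  have even': "(\<lambda>k. x (N + 2 * Suc k)) \<longlonglongrightarrow> l"
    using LIMSEQ_Suc[OF even] by simp
  have odd': "(\<lambda>k. x (N + 1 + 2 * Suc k)) \<longlonglongrightarrow> l'"
    using LIMSEQ_Suc[OF odd] by simp
  have "x (N + 2 * Suc k) = f (x (N + 1 + 2 * k)) (x (N + 2 * k))" for k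
    using rec[of "N + 2 * k"] by (simp add: algebra_simps)
  with even' f_lim[OF odd even l0(2,1) nonneg nonneg] have l: "l = f l' l"
    using LIMSEQ_unique by simp
  have "x (N + 1 + 2 * Suc k) = f (x (N + 2 * Suc k)) (x (N + 1 + 2 * k))" for k
    using rec[of "N + 1 + 2 * k"] by (simp add: algebra_simps)
  with odd' f_lim[OF even' odd l0(1,2) nonneg nonneg] have l': "l' = f l l'"
    using LIMSEQ_unique by simp
  define p where "p = (\<lambda>n. if even (n + N) then l else l')"
  have "(\<lambda>n. x (n + N) - p (n + N)) \<longlonglongrightarrow> 0"
  proof (rule tendsto_even_odd)
    show "(\<lambda>n. x (2 * n + N) - p (2 * n + N)) \<longlonglongrightarrow> 0"
      using tendsto_diff[OF even tendsto_const[of l]] by (simp add: p_def add.commute)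
    show "(\<lambda>n. x (2 * n + 1 + N) - p (2 * n + 1 + N)) \<longlonglongrightarrow> 0"
      using tendsto_diff[OF odd tendsto_const[of l']] by (simp add: p_def algebra_simps)
  qed
  then have lim: "(\<lambda>n. x n - p n) \<longlonglongrightarrow> 0"
    using LIMSEQ_offset[of "\<lambda>n. x n - p n" N] by simp
  show ?thesis
  proof (cases "l = l'")
    case True
    then have "p = (\<lambda>n. l)" by (auto simp: p_def)
    with lim have "x \<longlonglongrightarrow> l" by (simp add: LIM_zero_iff)
    moreover have "is_equilibrium f l" using l l0 True by (simp add: is_equilibrium_iff)
    moreover have "l > 0" using l f_pos[OF l0(2,1)] by simp
    ultimately show ?thesis by (auto simp: tends_to_equilibrium_or_two_cycle_def)
  next
    case False
    have "is_prime_period_two f p"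
      using l l' l0 False by (auto simp: is_prime_period_two_def is_solution_def p_def)
    with lim show ?thesis by (auto simp: tends_to_equilibrium_or_two_cycle_def)
  qed
qed

text \<open>
  The two sign conditions say that, near the orbit, \<open>f\<close> decreases in its first argument and increases
  in its second.
\<close>

lemma converges_if_eventually_decreasing_increasing:
  assumes "\<forall>\<^sub>F n in sequentially. slope\<^sub>1 (x n) \<le> 0 \<and> slope\<^sub>2 (x n) \<ge> 0"
  shows "tends_to_equilibrium_or_two_cycle x"
proof -
  obtain N where N: "\<And>n. n \<ge> N \<Longrightarrow> slope\<^sub>1 (x n) \<le> 0 \<and> slope\<^sub>2 (x n) \<ge> 0"
    using assms by (auto simp: eventually_sequentially)
  have mono: "f (x j) (x i) \<le> f (x l) (x k)"
    if "x l \<le> x j" "x i \<le> x k" "k \<ge> N" "j \<ge> N" for i j k l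
  proof -
    \<comment> \<open>The order of the two moves matters: the sign of the slope is known at terms of the orbit
      with index at least \<open>N\<close>, here at \<open>x j\<close> and at \<open>x k\<close>.\<close>
    have "f (x j) (x i) \<le> f (x j) (x k)"
      using that N[of j] nonneg by (intro f_mono\<^sub>2) (auto intro: mult_nonneg_nonneg)
    also have "\<dots> \<le> f (x l) (x k)"
      using that N[of k] nonneg by (intro f_mono\<^sub>1) (auto intro: mult_nonpos_nonpos)
    finally show ?thesis .
  qed
  have step: "x (n + N + 2) = f (x (n + N + 1)) (x (n + N))"
    "x (n + N + 4) = f (x (n + N + 3)) (x (n + N + 2))" for n
    using rec[of "n + N"] rec[of "n + N + 2"] by (simp_all add: eval_nat_numeral)
  obtain M l l' where "(\<lambda>k. x (M + 2 * k + N)) \<longlonglongrightarrow> l" "(\<lambda>k. x (M + 1 + 2 * k + N)) \<longlonglongrightarrow> l'"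
  proof (rule bounded_alternating_increments_converge[of "\<lambda>n. x (n + N)"])
    show "bounded (range (\<lambda>n. x (n + N)))"
      using bounded by (rule bounded_subset) auto
    fix n
    show "x (n + 2 + N) \<le> x (n + 4 + N)"
      if "x (n + N) \<le> x (n + 2 + N)" "x (n + 3 + N) \<le> x (n + 1 + N)"
      using mono[of "n + 3 + N" "n + 1 + N" "n + N" "n + 2 + N"] that step[of n]
      by (simp add: ac_simps)
    show "x (n + 4 + N) \<le> x (n + 2 + N)"
      if "x (n + 2 + N) \<le> x (n + N)" "x (n + 1 + N) \<le> x (n + 3 + N)"
      using mono[of "n + 1 + N" "n + 3 + N" "n + 2 + N" "n + N"] that step[of n]
      by (simp add: ac_simps)
  qed blast
  then show ?thesis
    using converges_if_parity_subsequences_converge[of "M + N" l l'] by (simp add: ac_simps)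
qed

end


section \<open>The Lyapunov function in the increasing-decreasing regime\<close>

definition symmetric_biquadratic ::
  "real \<Rightarrow> real \<Rightarrow> real \<Rightarrow> real \<Rightarrow> real \<Rightarrow> real \<Rightarrow> real \<Rightarrow> real \<Rightarrow> real" where
  "symmetric_biquadratic m00 m01 m02 m11 m12 m22 s t =
     (m00 + m01 * s + m02 * s\<^sup>2) + (m01 + m11 * s + m12 * s\<^sup>2) * t + (m02 + m12 * s + m22 * s\<^sup>2) * t\<^sup>2"

lemma symmetric_biquadratic_commute:
  "symmetric_biquadratic m00 m01 m02 m11 m12 m22 s t = symmetric_biquadratic m00 m01 m02 m11 m12 m22 t s"
  by (simp add: symmetric_biquadratic_def algebra_simps)

text \<open>
  The relation \<open>P * (y * z) + Q * (y + z) - R = 0\<close> is an involution exchanging \<open>y\<close> and \<open>z\<close>. The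
  hypotheses say that it exchanges the two roots of each of the two quadratics, which makes their
  quotient invariant under it. The identity measures the change of the quotient off the relation.
\<close>

lemma quadratic_pencil_involution:
  fixes P Q R :: real
  assumes "P * n0 = Q * n1 + R * n2" "P * d0 = Q * d1 + R * d2"
  shows "P * ((n0 + n1 * z + n2 * z\<^sup>2) * (d0 + d1 * y + d2 * y\<^sup>2)
            - (n0 + n1 * y + n2 * y\<^sup>2) * (d0 + d1 * z + d2 * z\<^sup>2))
       = (z - y) * (n2 * d1 - n1 * d2) * (P * (y * z) + Q * (y + z) - R)"
proof -
  have "P * ((n0 + n1 * z + n2 * z\<^sup>2) * (d0 + d1 * y + d2 * y\<^sup>2)
            - (n0 + n1 * y + n2 * y\<^sup>2) * (d0 + d1 * z + d2 * z\<^sup>2))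
      = (P * n0 + P * n1 * z + P * n2 * z\<^sup>2) * (d0 + d1 * y + d2 * y\<^sup>2)
            - (P * n0 + P * n1 * y + P * n2 * y\<^sup>2) * (d0 + d1 * z + d2 * z\<^sup>2)"
    by (simp add: algebra_simps)
  also have "\<dots> = P * n0 * (d1 * (y - z) + d2 * (y\<^sup>2 - z\<^sup>2))
      + P * d0 * (n1 * (z - y) + n2 * (z\<^sup>2 - y\<^sup>2))
      + P * (n2 * d1 - n1 * d2) * (z - y) * (y * z)"
    by (simp add: algebra_simps power2_eq_square)
  also have "\<dots> = (z - y) * (n2 * d1 - n1 * d2) * (P * (y * z) + Q * (y + z) - R)"
    unfolding assms by (simp add: algebra_simps power2_eq_square)
  finally show ?thesis .
qed

context rational_recursion
begin

text \<open>
  For consecutive terms \<open>y, x, z\<close> the recursion can be written in the form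
  \<open>2 * C * (y * z) + (A - \<gamma> + B * x) * (y + z) - 2 * (\<alpha> + \<beta> * x) = - (z - y) * (A + \<gamma> + B * x)\<close>.
  With right-hand side 0 this is a symmetric QRT map (a generalisation of Lyness' equation). A symmetric
  biquadratic, read as a quadratic in one variable, is compatible with its involution for every
  \<open>x\<close> when the coefficients satisfy \<open>2 * C * m00 = (A - \<gamma>) * m01 + 2 * \<alpha> * m02\<close> and three more linear
  equations, one for each power of \<open>x\<close>. Six coefficients subject to four equations leave a
  pencil of solutions. The solution with \<open>m12 = m22 = 0\<close>, unique up to scaling, is the denominator. The numerator is the one with
  \<open>m11 = 0\<close> and \<open>m22 = - B\<close>, which gives it the sign for which the quotient decreases.
\<close>

definition lyap_den :: "real \<Rightarrow> real \<Rightarrow> real" where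
  "lyap_den = symmetric_biquadratic
     (((A - \<gamma>) * (C * (A - \<gamma>) + \<beta> * B) + \<alpha> * B * (2 * C - B)) / C)
     (2 * (C * (A - \<gamma>) + \<beta> * B)) (B * (2 * C - B)) (2 * C * (2 * C - B)) 0 0"

definition lyap_num :: "real \<Rightarrow> real \<Rightarrow> real" where
  "lyap_num = (let m02 = (\<beta> * (A - \<gamma> + 2 * \<beta>) - \<alpha> * B) / C;
     m01 = (4 * \<alpha> * \<beta> + 2 * \<beta> * m02) / (2 * C - B)
   in symmetric_biquadratic (((A - \<gamma>) * m01 + 2 * \<alpha> * m02) / (2 * C)) m01 m02 0 (2 * \<beta>) (- B))"

text \<open>
  Half of the 2 by 2 minor of the leading and middle coefficients of numerator and denominator; this minor
  governs how fast the quotient changes, and it happens to factor.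
\<close>

definition dissipation :: "real \<Rightarrow> real" where
  "dissipation t = ((2 * C - B) * t + A + 2 * \<beta> - \<gamma>)
     * (\<beta> * (A - \<gamma>) - \<alpha> * B + 2 * \<beta> * C * t - B * C * t\<^sup>2)"

text \<open>
  The invariance of the quotient under the QRT map turns into a change proportional to \<open>(z - y)\<^sup>2\<close>,
  since the recursion violates the symmetric relation by a multiple of \<open>z - y\<close>.
\<close>

lemma lyapunov_step:
  assumes k: "2 * C - B \<noteq> 0" and z: "z * (A + B * x + C * y) = \<alpha> + \<beta> * x + \<gamma> * y"
  shows "C * (lyap_num x z * lyap_den x y - lyap_num x y * lyap_den x z)
       = - (z - y)\<^sup>2 * dissipation x * (A + \<gamma> + B * x)"
proof -
  define k where "k = 2 * C - B"
  define a where "a = A - \<gamma>"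
  define d01 where "d01 = 2 * (C * a + \<beta> * B)"
  define d00 where "d00 = (a * (C * a + \<beta> * B) + \<alpha> * B * k) / C"
  define m02 where "m02 = (\<beta> * (a + 2 * \<beta>) - \<alpha> * B) / C"
  define m01 where "m01 = (4 * \<alpha> * \<beta> + 2 * \<beta> * m02) / k"
  define m00 where "m00 = (a * m01 + 2 * \<alpha> * m02) / (2 * C)"
  have den: "lyap_den = symmetric_biquadratic d00 d01 (B * k) (2 * C * k) 0 0"
    by (simp add: lyap_den_def d00_def d01_def k_def a_def)
  have num: "lyap_num = symmetric_biquadratic m00 m01 m02 0 (2 * \<beta>) (- B)"
    by (simp add: lyap_num_def m00_def m01_def m02_def k_def a_def Let_def)
  have r1: "C * d00 = a * (C * a + \<beta> * B) + \<alpha> * B * k"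
    using C_pos by (simp add: d00_def)
  have r2: "C * m02 = \<beta> * (a + 2 * \<beta>) - \<alpha> * B"
    using C_pos by (simp add: m02_def)
  have r3: "k * m01 = 4 * \<alpha> * \<beta> + 2 * \<beta> * m02"
    using assms(1) by (simp add: m01_def k_def)
  have r4: "2 * C * m00 = a * m01 + 2 * \<alpha> * m02"
    using C_pos by (simp add: m00_def)
  define n0 n1 n2 where "n0 = m00 + m01 * x + m02 * x\<^sup>2"
    and "n1 = m01 + 0 * x + 2 * \<beta> * x\<^sup>2" and "n2 = m02 + 2 * \<beta> * x + - B * x\<^sup>2"
  define d0 d1 d2 where "d0 = d00 + d01 * x + B * k * x\<^sup>2"
    and "d1 = d01 + 2 * C * k * x + 0 * x\<^sup>2" and "d2 = B * k + 0 * x + 0 * x\<^sup>2"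
  have inv_n: "2 * C * n0 = (a + B * x) * n1 + 2 * (\<alpha> + \<beta> * x) * n2"
  proof -
    have "2 * C * n0 - ((a + B * x) * n1 + 2 * (\<alpha> + \<beta> * x) * n2)
      = (2 * C * m00 - (a * m01 + 2 * \<alpha> * m02)) + (k * m01 - (4 * \<alpha> * \<beta> + 2 * \<beta> * m02)) * x
        + 2 * (C * m02 - (\<beta> * (a + 2 * \<beta>) - \<alpha> * B)) * x\<^sup>2"
      by (simp add: n0_def n1_def n2_def k_def algebra_simps power2_eq_square)
    then show ?thesis by (simp add: r2 r3 r4)
  qed
  have inv_d: "2 * C * d0 = (a + B * x) * d1 + 2 * (\<alpha> + \<beta> * x) * d2"
  proof -
    have "2 * C * d0 - ((a + B * x) * d1 + 2 * (\<alpha> + \<beta> * x) * d2)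
      = 2 * (C * d00 - (a * (C * a + \<beta> * B) + \<alpha> * B * k))"
      by (simp add: d0_def d1_def d2_def d01_def k_def algebra_simps power2_eq_square)
    then show ?thesis by (simp add: r1)
  qed
  have diss: "n2 * d1 - n1 * d2 = 2 * dissipation x"
  proof -
    have "n2 * d1 - n1 * d2 = (C * m02) * (2 * a + 2 * k * x) + (2 * \<beta> * x - B * x\<^sup>2) * (d01 + 2 * C * k * x)
        + 2 * \<beta> * B * m02 - B * (k * m01) - 2 * \<beta> * B * k * x\<^sup>2"
      by (simp add: n2_def d1_def n1_def d2_def d01_def algebra_simps power2_eq_square)
    also have "\<dots> = 2 * dissipation x"
      unfolding r2 r3 unfolding dissipation_def d01_def k_def a_def
      by (simp add: algebra_simps power2_eq_square)
    finally show ?thesis .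
  qed
  have rel: "2 * C * (y * z) + (a + B * x) * (y + z) - 2 * (\<alpha> + \<beta> * x)
      = - (z - y) * (A + \<gamma> + B * x)"
    using z by (simp add: a_def algebra_simps)
  have "2 * C * (lyap_num x z * lyap_den x y - lyap_num x y * lyap_den x z)
      = (z - y) * (n2 * d1 - n1 * d2)
        * (2 * C * (y * z) + (a + B * x) * (y + z) - 2 * (\<alpha> + \<beta> * x))"
    using quadratic_pencil_involution[OF inv_n inv_d, of z y]
    unfolding den num symmetric_biquadratic_def n0_def n1_def n2_def d0_def d1_def d2_def .
  also have "\<dots> = 2 * (- (z - y)\<^sup>2 * dissipation x * (A + \<gamma> + B * x))"
    unfolding rel diss by (simp add: algebra_simps power2_eq_square)
  finally show ?thesis by simp
qed

text \<open>
  In the coordinates \<open>y - \<gamma> / C\<close> and \<open>z - \<gamma> / C\<close> all coefficients are positive when \<open>B < C\<close>.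
\<close>

lemma lyap_den_pos:
  assumes "C > B" "C * y \<ge> \<gamma>" "C * z \<ge> \<gamma>"
  shows "lyap_den y z > 0"
proof -
  define g where "g = \<gamma> / C"
  have \<gamma>: "\<gamma> = C * g" and g: "g > 0" using C_pos \<gamma>_pos by (simp_all add: g_def)
  define \<eta> \<zeta> where "\<eta> = y - g" and "\<zeta> = z - g"
  have nn: "\<eta> \<ge> 0" "\<zeta> \<ge> 0"
    using assms C_pos by (simp_all add: \<eta>_def \<zeta>_def g_def pos_divide_le_eq mult.commute)
  have yz: "y = g + \<eta>" "z = g + \<zeta>" by (simp_all add: \<eta>_def \<zeta>_def)
  have BB: "B * B < C * B" "B * C < C * C" using assms B_pos C_pos by simp_all
  define c1 where "c1 = 2 * (C * A + \<beta> * B + g * (C * C + B * C - B * B))"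
  define c0 where "c0 = C * A * A + 2 * C * C * A * g + \<beta> * B * A + 3 * \<beta> * B * C * g
      + \<alpha> * B * (2 * C - B) + C * (C * C + 2 * B * C - 2 * B * B) * g * g"
  have "0 < C * C + B * C - B * B"
    using BB mult_pos_pos[OF C_pos C_pos] by (simp add: mult.commute)
  then have c1: "c1 > 0" unfolding c1_def using param_pos g by (intro mult_pos_pos add_pos_pos) auto
  have c0: "c0 > 0"
  proof -
    have "0 < C * C + 2 * (C * B - B * B)"
      using BB mult_pos_pos[OF C_pos C_pos] by simp
    then have "0 < C * C + 2 * B * C - 2 * B * B" by (simp add: algebra_simps)
    then show ?thesis unfolding c0_def using assms param_pos g by (simp add: add_pos_pos)
  qed
  have "C * lyap_den y z = c0 + C * c1 * (\<eta> + \<zeta>)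
      + C * (2 * C - B) * (2 * C * (\<eta> * \<zeta>) + B * (\<eta>\<^sup>2 + \<zeta>\<^sup>2))"
    unfolding lyap_den_def symmetric_biquadratic_def yz c0_def c1_def unfolding \<gamma> using C_pos
    by (simp add: field_simps power2_eq_square)
  also have "\<dots> > 0"
    using c0 c1 nn assms param_pos by (intro add_pos_nonneg) auto
  finally show ?thesis using C_pos by (simp add: zero_less_mult_iff)
qed

lemma continuous_symmetric_biquadratic:
  "continuous_on S (\<lambda>p. symmetric_biquadratic m00 m01 m02 m11 m12 m22 (fst p) (snd p))"
  unfolding symmetric_biquadratic_def by (intro continuous_intros)

lemma continuous_lyap:
  "continuous_on S (\<lambda>p. lyap_num (fst p) (snd p))" "continuous_on S (\<lambda>p. lyap_den (fst p) (snd p))"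
  by (simp_all add: lyap_num_def lyap_den_def Let_def continuous_symmetric_biquadratic)

end

context solution
begin

text \<open>
  On a square where denominator and dissipation are positive the quotient is bounded, and it drops at
  each step by at least a constant times \<open>(x (n + 2) - x n)\<^sup>2\<close>. These drops are therefore null.
\<close>

lemma two_step_increments_vanish:
  assumes ev: "\<forall>\<^sub>F n in sequentially. x n \<in> {l..u}" and l: "l \<ge> 0" and lu: "l \<le> u"
    and k: "2 * C - B \<noteq> 0"
    and den: "\<And>y z. y \<in> {l..u} \<Longrightarrow> z \<in> {l..u} \<Longrightarrow> lyap_den y z > 0"
    and diss: "\<And>t. t \<in> {l..u} \<Longrightarrow> dissipation t > 0"
  shows "(\<lambda>n. x (n + 2) - x n) \<longlonglongrightarrow> 0"
proof -
  let ?K = "{l..u} \<times> {l..u}"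
  have K: "compact ?K" "?K \<noteq> {}" using lu by (auto intro: compact_Times)
  obtain M where M: "\<And>p. p \<in> ?K \<Longrightarrow> lyap_den (fst p) (snd p) \<le> M"
    using continuous_attains_sup[OF K continuous_lyap(2)] by blast
  have cV: "continuous_on ?K (\<lambda>p. lyap_num (fst p) (snd p) / lyap_den (fst p) (snd p))"
    by (intro continuous_intros continuous_lyap) (use den in force)
  obtain m where m: "\<And>p. p \<in> ?K \<Longrightarrow> m \<le> lyap_num (fst p) (snd p) / lyap_den (fst p) (snd p)"
    using continuous_attains_inf[OF K cV] by blast
  have cD: "continuous_on {l..u} dissipation"
    unfolding dissipation_def by (intro continuous_intros)
  obtain t0 where t0: "t0 \<in> {l..u}" "\<And>t. t \<in> {l..u} \<Longrightarrow> dissipation t0 \<le> dissipation t"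
    using continuous_attains_inf[OF compact_Icc _ cD] lu by force
  define c where "c = dissipation t0 * A / (C * M\<^sup>2)"
  have Mpos: "M > 0" using M[of "(l, l)"] den[of l l] lu by simp
  have cpos: "c > 0" using diss[OF t0(1)] param_pos Mpos by (simp add: c_def)
  obtain N where N: "\<And>n. n \<ge> N \<Longrightarrow> x n \<in> {l..u}"
    using ev by (auto simp: eventually_sequentially)
  define V where "V n = lyap_num (x (n + N)) (x (n + N + 1)) / lyap_den (x (n + N)) (x (n + N + 1))" for n
  have step: "c * (x (n + N + 2) - x (n + N))\<^sup>2 \<le> V n - V (Suc n)" for n
  proof -
    define y t z where "y = x (n + N)" and "t = x (n + N + 1)" and "z = x (n + N + 2)"
    have in_K: "y \<in> {l..u}" "t \<in> {l..u}" "z \<in> {l..u}"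
      unfolding y_def t_def z_def by (intro N; simp)+
    have nn: "y \<ge> 0" "t \<ge> 0" using in_K l by auto
    have zeq: "z * (A + B * t + C * y) = \<alpha> + \<beta> * t + \<gamma> * y"
      using rec[of "n + N"] eq_f_iff[OF nn(2,1)] by (simp add: y_def t_def z_def)
    have dy: "lyap_den t y > 0" and dz: "lyap_den t z > 0" using den in_K by auto
    have V: "V n = lyap_num t y / lyap_den t y" "V (Suc n) = lyap_num t z / lyap_den t z"
      unfolding V_def y_def t_def z_def lyap_num_def lyap_den_def Let_def
      by (simp_all add: symmetric_biquadratic_commute)
    have "V n - V (Suc n) = (z - y)\<^sup>2 * (dissipation t * (A + \<gamma> + B * t) / (C * (lyap_den t y * lyap_den t z)))"
    proof -
      have "V n - V (Suc n) = C * (lyap_num t y * lyap_den t z - lyap_num t z * lyap_den t y)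
          / (C * (lyap_den t y * lyap_den t z))"
        using dy dz C_pos unfolding V by (simp add: diff_frac_eq)
      also have "C * (lyap_num t y * lyap_den t z - lyap_num t z * lyap_den t y)
          = (z - y)\<^sup>2 * (dissipation t * (A + \<gamma> + B * t))"
        using lyapunov_step[OF k zeq] by (simp add: algebra_simps)
      finally show ?thesis by simp
    qed
    moreover have "c \<le> dissipation t * (A + \<gamma> + B * t) / (C * (lyap_den t y * lyap_den t z))"
      unfolding c_def
    proof (rule frac_le)
      have "dissipation t0 * A \<le> dissipation t * (A + \<gamma> + B * t)"
        using t0(2)[OF in_K(2)] diss[OF in_K(2)] nn param_pos by (intro mult_mono) auto
      then show "dissipation t0 * A \<le> dissipation t * (A + \<gamma> + B * t)" .
      show "0 \<le> dissipation t * (A + \<gamma> + B * t)"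
        using diss[OF in_K(2)] nn param_pos by (intro mult_nonneg_nonneg) auto
      show "0 < C * (lyap_den t y * lyap_den t z)" using dy dz C_pos by simp
      have "lyap_den t y * lyap_den t z \<le> M * M"
        using M[of "(t, y)"] M[of "(t, z)"] in_K dy dz by (intro mult_mono) auto
      then show "C * (lyap_den t y * lyap_den t z) \<le> C * M\<^sup>2"
        using C_pos by (simp add: power2_eq_square)
    qed
    ultimately have "c * (z - y)\<^sup>2 \<le> V n - V (Suc n)"
      by (subst mult.commute) (simp only: mult_left_mono zero_le_power2)
    then show ?thesis by (simp only: y_def z_def)
  qed
  have "decseq V"
  proof (rule decseq_SucI)
    fix n
    have "0 \<le> c * (x (n + N + 2) - x (n + N))\<^sup>2" using cpos by simp
    with step[of n] show "V (Suc n) \<le> V n" by linarith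
  qed
  moreover have "m \<le> V n" for n
    using m[of "(x (n + N), x (n + N + 1))"] N by (simp add: V_def)
  ultimately obtain L where L: "V \<longlonglongrightarrow> L" using decseq_convergent by blast
  have "(\<lambda>n. (V n - V (Suc n)) / c) \<longlonglongrightarrow> (L - L) / c"
    by (intro tendsto_intros L LIMSEQ_Suc[OF L]) (use cpos in simp)
  then have V0: "(\<lambda>n. (V n - V (Suc n)) / c) \<longlonglongrightarrow> 0" by simp
  have "(\<lambda>n. (x (n + N + 2) - x (n + N))\<^sup>2) \<longlonglongrightarrow> 0"
  proof (rule Lim_null_comparison[OF _ V0], rule always_eventually, rule allI)
    fix n
    show "norm ((x (n + N + 2) - x (n + N))\<^sup>2) \<le> (V n - V (Suc n)) / c"
      using step[of n] cpos by (simp add: field_simps)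
  qed
  then have "(\<lambda>n. x (n + N + 2) - x (n + N)) \<longlonglongrightarrow> 0"
    using tendsto_real_sqrt[of "\<lambda>n. (x (n + N + 2) - x (n + N))\<^sup>2" 0]
    by (simp add: tendsto_rabs_zero_iff)
  then show ?thesis
    by (intro LIMSEQ_offset[of "\<lambda>n. x (n + 2) - x n" N]) (simp add: ac_simps)
qed

text \<open>
  If \<open>x (n + 2) - x n\<close> is small, then consecutive terms nearly form a two-cycle. The two equations
  of a two-cycle differ by \<open>(x (n + 1) - x n) * (A + C * (x (n + 1) + x n) + \<beta> - \<gamma>)\<close>, and the second
  factor is at least \<open>A\<close> when \<open>\<gamma> \<le> \<beta>\<close>; so consecutive terms approach each other too.
\<close>

lemma converges_if_two_step_increments_vanish:
  assumes diff: "(\<lambda>n. x (n + 2) - x n) \<longlonglongrightarrow> 0" and "\<gamma> \<le> \<beta>"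
  shows "tends_to_equilibrium_or_two_cycle x"
proof -
  obtain e where e: "e > 0" "is_equilibrium f e" using equilibrium_exists by blast
  obtain M where M: "\<And>n. \<bar>x n\<bar> \<le> M" using bounded by (auto simp: bounded_iff)
  have null_times_bounded: "(\<lambda>n. g n * h n) \<longlonglongrightarrow> 0"
    if "g \<longlonglongrightarrow> 0" "\<And>n. \<bar>h n\<bar> \<le> H" for g h :: "nat \<Rightarrow> real" and H
  proof (rule Lim_null_comparison)
    show "(\<lambda>n. \<bar>g n\<bar> * H) \<longlonglongrightarrow> 0"
      using tendsto_mult_left_zero[OF tendsto_rabs_zero[OF that(1)]] .
    show "\<forall>\<^sub>F n in sequentially. norm (g n * h n) \<le> \<bar>g n\<bar> * H"
      using that(2) by (intro always_eventually) (simp add: abs_mult mult_left_mono)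
  qed
  \<comment> \<open>\<open>\<rho>\<close> and, below, \<open>?\<sigma>\<close> are the defects in the two equations of a two-cycle.\<close>
  define \<rho> where "\<rho> n = x n * (A + B * x (n + 1) + C * x n) - (\<alpha> + \<beta> * x (n + 1) + \<gamma> * x n)" for n
  have den_bound: "\<bar>A + B * x (n + 1) + C * x n\<bar> \<le> A + B * M + C * M" for n
    using denom_pos[OF nonneg nonneg, of "n + 1" n] M[of n] M[of "n + 1"] param_pos
    by (simp add: abs_le_iff add_mono mult_left_mono)
  have \<rho>: "\<rho> \<longlonglongrightarrow> 0"
  proof -
    have "\<rho> = (\<lambda>n. - (x (n + 2) - x n) * (A + B * x (n + 1) + C * x n))"
    proof
      fix n
      show "\<rho> n = - (x (n + 2) - x n) * (A + B * x (n + 1) + C * x n)"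
      using iffD1[OF eq_f_iff[OF nonneg nonneg] rec[of n]]
        by (simp add: \<rho>_def algebra_simps)
    qed
    moreover have "(\<lambda>n. - (x (n + 2) - x n) * (A + B * x (n + 1) + C * x n)) \<longlonglongrightarrow> 0"
      using tendsto_minus[OF diff] by (intro null_times_bounded[OF _ den_bound]) simp
    ultimately show ?thesis by (simp only:)
  qed
  have swap: "(\<lambda>n. x (n + 1) - x n) \<longlonglongrightarrow> 0"
  proof (rule Lim_null_comparison)
    let ?\<sigma> = "\<lambda>n. x (n + 1) * (A + B * x n + C * x (n + 1)) - (\<alpha> + \<beta> * x n + \<gamma> * x (n + 1))"
    have "?\<sigma> n = \<rho> (n + 1) - (x (n + 2) - x n) * (B * x (n + 1) - \<beta>)" for n
      by (simp add: \<rho>_def algebra_simps)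
    moreover have lim: "(\<lambda>n. (x (n + 2) - x n) * (B * x (n + 1) - \<beta>)) \<longlonglongrightarrow> 0"
    proof (rule null_times_bounded[OF diff])
      fix n
      have "\<bar>B * x (n + 1)\<bar> \<le> B * M"
        using M[of "n + 1"] B_pos by (simp add: abs_mult)
      then show "\<bar>B * x (n + 1) - \<beta>\<bar> \<le> B * M + \<beta>" using \<beta>_pos by linarith
    qed
    ultimately have \<sigma>: "?\<sigma> \<longlonglongrightarrow> 0"
      using tendsto_diff[OF LIMSEQ_ignore_initial_segment[OF \<rho>, of 1] lim] by simp
    show "(\<lambda>n. \<bar>?\<sigma> n - \<rho> n\<bar> / A) \<longlonglongrightarrow> 0"
      using tendsto_divide_zero[OF tendsto_rabs_zero[OF tendsto_diff[OF \<sigma> \<rho>, simplified]]] by simp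
    have "norm (x (n + 1) - x n) \<le> \<bar>?\<sigma> n - \<rho> n\<bar> / A" for n
    proof -
      have "?\<sigma> n - \<rho> n = (x (n + 1) - x n) * (A + C * (x (n + 1) + x n) + (\<beta> - \<gamma>))"
        by (simp add: \<rho>_def algebra_simps)
      then have "\<bar>?\<sigma> n - \<rho> n\<bar> = \<bar>x (n + 1) - x n\<bar> * \<bar>A + C * (x (n + 1) + x n) + (\<beta> - \<gamma>)\<bar>"
        by (simp add: abs_mult)
      moreover have "A \<le> A + C * (x (n + 1) + x n) + (\<beta> - \<gamma>)"
        using assms(2) C_pos nonneg by simp
      then have "\<bar>x (n + 1) - x n\<bar> * A
          \<le> \<bar>x (n + 1) - x n\<bar> * \<bar>A + C * (x (n + 1) + x n) + (\<beta> - \<gamma>)\<bar>"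
        by (intro mult_left_mono) auto
      ultimately show ?thesis using A_pos by (simp add: field_simps)
    qed
    then show "\<forall>\<^sub>F n in sequentially. norm (x (n + 1) - x n) \<le> \<bar>?\<sigma> n - \<rho> n\<bar> / A" by simp
  qed
  have "x \<longlonglongrightarrow> e"
  proof (rule tendsto_equilibrium[OF e(2,1) nonneg])
    have "x n * (A + B * x n + C * x n) - (\<alpha> + \<beta> * x n + \<gamma> * x n)
        = \<rho> n - (x (n + 1) - x n) * (B * x n - \<beta>)" for n
      by (simp add: \<rho>_def algebra_simps)
    moreover have lim: "(\<lambda>n. (x (n + 1) - x n) * (B * x n - \<beta>)) \<longlonglongrightarrow> 0"
    proof (rule null_times_bounded[OF swap])
      fix n
      have "\<bar>B * x n\<bar> \<le> B * M"
        using M[of n] B_pos by (simp add: abs_mult)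
      then show "\<bar>B * x n - \<beta>\<bar> \<le> B * M + \<beta>" using \<beta>_pos by linarith
    qed
    ultimately show "(\<lambda>n. x n * (A + B * x n + C * x n) - (\<alpha> + \<beta> * x n + \<gamma> * x n)) \<longlonglongrightarrow> 0"
      using tendsto_diff[OF \<rho> lim] by simp
  qed
  with e show ?thesis by (auto simp: tends_to_equilibrium_or_two_cycle_def)
qed

end

section \<open>Limit inferior and limit superior\<close>

context rational_recursion
begin

text \<open>
  The next three lemmas subtract the inequalities that hold at two corners of the square with side \<open>{I..S}\<close>;
  after division by \<open>S - I\<close> the remainder contradicts the positivity of the parameters. In the first two it
  gives \<open>A + (B + C) * I < \<beta> + \<gamma>\<close>, which \<open>f I I \<le> I\<close> excludes because of \<open>\<alpha> > 0\<close>.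
\<close>

lemma no_low_fixed_high_cross:
  assumes "0 \<le> I" "I < S" "f I I \<le> I" "S \<le> f I S"
  shows False
proof -
  from assms have 1: "S * (A + B * I + C * S) \<le> \<alpha> + \<beta> * I + \<gamma> * S"
    and 2: "\<alpha> + \<beta> * I + \<gamma> * I \<le> I * (A + B * I + C * I)"
    by (simp_all add: le_f_iff f_le_iff)
  have "(S - I) * (A + B * I + C * (S + I) - \<gamma>) \<le> 0"
    using 1 2 by (simp add: algebra_simps)
  then have "A + B * I + C * (S + I) - \<gamma> \<le> 0"
    using assms by (simp add: mult_le_0_iff)
  then have "I * (A + B * I + C * (S + I) - \<gamma>) \<le> 0"
    using assms by (simp add: mult_le_0_iff)
  moreover have "0 \<le> C * (S * I)" "0 \<le> \<beta> * I" using assms param_pos by simp_all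
  ultimately show False using 2 \<alpha>_pos by (simp add: algebra_simps)
qed

lemma no_low_fixed_high_cross':
  assumes "0 \<le> I" "I < S" "f I I \<le> I" "S \<le> f S I"
  shows False
proof -
  from assms have 1: "S * (A + B * S + C * I) \<le> \<alpha> + \<beta> * S + \<gamma> * I"
    and 2: "\<alpha> + \<beta> * I + \<gamma> * I \<le> I * (A + B * I + C * I)"
    by (simp_all add: le_f_iff f_le_iff)
  have "(S - I) * (A + B * (S + I) + C * I - \<beta>) \<le> 0"
    using 1 2 by (simp add: algebra_simps)
  then have "A + B * (S + I) + C * I - \<beta> \<le> 0"
    using assms by (simp add: mult_le_0_iff)
  then have "I * (A + B * (S + I) + C * I - \<beta>) \<le> 0"
    using assms by (simp add: mult_le_0_iff)
  moreover have "0 \<le> B * (S * I)" "0 \<le> \<gamma> * I" using assms param_pos by simp_all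
  ultimately show False using 2 \<alpha>_pos by (simp add: algebra_simps)
qed

lemma no_high_from_low:
  assumes "0 \<le> I" "I < S" "S \<le> f I I" and low: "f S S \<le> I \<or> f S I \<le> I \<or> f I S \<le> I"
  shows False
proof -
  from assms have 1: "S * (A + B * I + C * I) \<le> \<alpha> + \<beta> * I + \<gamma> * I"
    by (simp add: le_f_iff)
  have pos: "0 < A * (S - I)" "0 < \<beta> * (S - I)" "0 < \<gamma> * (S - I)"
    "0 \<le> B * (I * (S - I))" "0 \<le> C * (I * (S - I))"
    using assms param_pos by simp_all
  from low consider "\<alpha> + \<beta> * S + \<gamma> * S \<le> I * (A + B * S + C * S)"
    | "\<alpha> + \<beta> * S + \<gamma> * I \<le> I * (A + B * S + C * I)"
    | "\<alpha> + \<beta> * I + \<gamma> * S \<le> I * (A + B * I + C * S)"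
    using assms by (auto simp: f_le_iff)
  then show False
    using 1 pos by cases (simp_all add: algebra_simps)
qed

lemma slope_relation: "C * (\<beta> * A - B * \<alpha>) + A * (\<gamma> * B - \<beta> * C) = B * (\<gamma> * A - C * \<alpha>)"
  by (simp add: algebra_simps)

text \<open>
  The limit of \<open>f u v\<close> as \<open>v\<close> grows is \<open>\<gamma> / C\<close>, so \<open>f u\<close> lies above this value where it decreases. In the
  same way \<open>f u v\<close> lies below its limit \<open>\<beta> / B\<close> in \<open>u\<close> where it increases in \<open>u\<close>.
\<close>

lemma f_ge_if_slope\<^sub>2: "\<gamma> \<le> C * f u v" if "slope\<^sub>2 u \<le> 0" "u \<ge> 0" "v \<ge> 0"
proof -
  have "\<gamma> / C \<le> f u v"
    unfolding le_f_iff[OF that(2,3)] using that param_pos by (simp add: slope\<^sub>2_def field_simps)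
  then show ?thesis using C_pos by (simp add: pos_divide_le_eq mult.commute)
qed

lemma f_le_if_slope\<^sub>1: "B * f u v \<le> \<beta>" if "slope\<^sub>1 v \<ge> 0" "u \<ge> 0" "v \<ge> 0"
proof -
  have "f u v \<le> \<beta> / B"
    unfolding f_le_iff[OF that(2,3)] using that param_pos by (simp add: slope\<^sub>1_def field_simps)
  then show ?thesis using B_pos by (simp add: pos_le_divide_eq mult.commute)
qed

text \<open>
  These two inequalities are all that is left of a nondegenerate pair \<open>I < S\<close> in the
  increasing-decreasing regime. They do not contradict each other, but they force \<open>\<gamma> < \<beta>\<close> and \<open>B < C\<close>, which
  is where the Lyapunov function works.
\<close>

lemma increasing_decreasing_bounds:
  assumes "0 \<le> I" "I < S" "S \<le> f S I" "f I S \<le> I"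
  shows "A + B * (S + I) \<le> \<beta> - \<gamma>" "\<alpha> + \<gamma> * (S + I) \<le> (C - B) * (I * S)"
proof -
  from assms have 1: "S * (A + B * S + C * I) \<le> \<alpha> + \<beta> * S + \<gamma> * I"
    and 2: "\<alpha> + \<beta> * I + \<gamma> * S \<le> I * (A + B * I + C * S)"
    by (simp_all add: le_f_iff f_le_iff)
  have "(S - I) * (A + B * (S + I) + \<gamma> - \<beta>) \<le> 0"
    using 1 2 by (simp add: algebra_simps)
  then show *: "A + B * (S + I) \<le> \<beta> - \<gamma>"
    using assms by (simp add: mult_le_0_iff)
  have "I * (A + B * (S + I)) \<le> I * (\<beta> - \<gamma>)"
    by (rule mult_left_mono[OF *]) fact
  with 2 show "\<alpha> + \<gamma> * (S + I) \<le> (C - B) * (I * S)"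
    by (simp add: algebra_simps)
qed

text \<open>
  The second inequality bounds \<open>\<alpha> * B\<close> by \<open>(C - B) * I * (B * S)\<close> minus a positive term; the first then bounds \<open>B * S\<close>.
  What remains is \<open>\<beta> * A\<close> plus terms that are nonnegative by \<open>\<gamma> \<le> C * I\<close> and \<open>B * I \<le> \<beta>\<close>.
\<close>

lemma dissipation_factor_pos:
  assumes I: "0 < I" "\<gamma> \<le> C * I" "B * I \<le> \<beta>" and CB: "B < C"
    and 1: "A + B * (S + I) \<le> \<beta> - \<gamma>" and 2: "\<alpha> + \<gamma> * (S + I) \<le> (C - B) * (I * S)"
    and S: "I < S"
  shows "\<beta> * (A - \<gamma>) - \<alpha> * B + 2 * \<beta> * C * I - B * C * I\<^sup>2 > 0"
proof -
  have a: "B * \<alpha> + B * (\<gamma> * (S + I)) \<le> B * ((C - B) * (I * S))"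
    using mult_left_mono[OF 2, of B] B_pos by (simp add: algebra_simps)
  have b: "((C - B) * I) * (A + B * (S + I)) \<le> ((C - B) * I) * (\<beta> - \<gamma>)"
    by (rule mult_left_mono[OF 1]) (use I CB in auto)
  have c: "\<beta> * \<gamma> \<le> \<beta> * (C * I)" using I \<beta>_pos by (intro mult_left_mono) auto
  have d: "(B * I) * (B * I) \<le> \<beta> * (B * I)" using I B_pos by (intro mult_right_mono) auto
  have e: "0 \<le> ((C - B) * I) * (\<gamma> + A)" "0 < \<beta> * A" "0 \<le> B * (\<gamma> * (S + I))"
    using I CB S param_pos by (auto intro: mult_nonneg_nonneg)
  show ?thesis
    using a b c d e by (simp add: algebra_simps power2_eq_square)
qed

end

context solution
begin

text \<open>
  The orbit eventually lies in every interval from slightly below \<open>I\<close>, but not below \<open>\<gamma> / C\<close>, up to \<open>\<beta> / B\<close>.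
  The quadratic factor \<open>F\<close> of the dissipation is positive at \<open>I\<close>, hence slightly below, and it
  increases up to its vertex \<open>\<beta> / B\<close>.
\<close>

lemma converges_if_increasing_decreasing:
  assumes IS: "0 < I" "I < S" "S \<le> f S I" "f I S \<le> I"
    and bounds: "\<gamma> \<le> C * I" "B * S \<le> \<beta>"
    and lo: "\<And>c. c < I \<Longrightarrow> \<forall>\<^sub>F n in sequentially. c < x n"
    and ev: "\<forall>\<^sub>F n in sequentially. slope\<^sub>1 (x n) \<ge> 0 \<and> slope\<^sub>2 (x n) \<le> 0"
  shows "tends_to_equilibrium_or_two_cycle x"
proof -
  note c = increasing_decreasing_bounds[OF less_imp_le[OF IS(1)] IS(2-)]
  have "0 < \<alpha> + \<gamma> * (S + I)" using IS param_pos by (simp add: add_pos_pos)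
  then have "0 < (C - B) * (I * S)" using c(2) by linarith
  then have CB: "B < C" using zero_less_mult_pos2[of "C - B" "I * S"] IS by simp
  have "0 < A + B * (S + I)" using IS param_pos by (simp add: add_pos_pos)
  then have \<beta>\<gamma>: "\<gamma> < \<beta>" using c(1) by linarith
  have BI: "B * I \<le> \<beta>" using IS bounds B_pos by (smt (verit) mult_left_mono)
  define F where "F = (\<lambda>t. \<beta> * (A - \<gamma>) - \<alpha> * B + 2 * \<beta> * C * t - B * C * t\<^sup>2)"
  have FI: "F I > 0"
    unfolding F_def by (rule dissipation_factor_pos[OF IS(1) bounds(1) BI CB c IS(2)])
  have "isCont F I" unfolding F_def by (intro continuous_intros)
  then have "\<forall>\<^sub>F t in nhds I. F t > 0"
    using FI order_tendstoD(1)[of F "F I" "nhds I" 0]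
    by (simp add: isCont_def tendsto_at_iff_tendsto_nhds)
  then obtain \<epsilon> where \<epsilon>: "\<epsilon> > 0" "\<And>t. \<bar>t - I\<bar> < \<epsilon> \<Longrightarrow> F t > 0"
    unfolding eventually_nhds_metric dist_real_def by blast
  define l u where "l = max (\<gamma> / C) (I - \<epsilon> / 2)" and "u = \<beta> / B"
  have gI: "\<gamma> / C \<le> I" using bounds C_pos by (simp add: pos_divide_le_eq mult.commute)
  have "I \<le> u" using BI B_pos by (simp add: u_def pos_le_divide_eq mult.commute)
  with gI \<epsilon>(1) have l: "l > 0" "l \<le> I" "\<bar>l - I\<bar> < \<epsilon>" "l \<le> u"
    using param_pos by (auto simp: l_def less_max_iff_disj)
  have Fl: "F l > 0" using \<epsilon>(2) l by simp
  have in_range: "C * t \<ge> \<gamma>" "B * t \<le> \<beta>" "t \<ge> l" if "t \<in> {l..u}" for t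
    using that B_pos C_pos by (auto simp: l_def u_def pos_divide_le_eq pos_le_divide_eq mult.commute)
  show ?thesis
  proof (rule converges_if_two_step_increments_vanish[OF two_step_increments_vanish])
    show "0 \<le> l" "l \<le> u" "\<gamma> \<le> \<beta>" "2 * C - B \<noteq> 0" using l \<beta>\<gamma> CB B_pos by auto
    show "lyap_den y z > 0" if "y \<in> {l..u}" "z \<in> {l..u}" for y z
      using that in_range CB by (intro lyap_den_pos)
    show "dissipation t > 0" if t: "t \<in> {l..u}" for t
    proof -
      have "0 \<le> C * ((t - l) * ((\<beta> - B * t) + (\<beta> - B * l)))"
        using in_range[OF t] in_range[of l] l C_pos by (intro mult_nonneg_nonneg) auto
      then have "F l \<le> F t" by (simp add: F_def algebra_simps power2_eq_square)
      with Fl have "0 < F t" by simp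
      moreover have "0 < (2 * C - B) * t" using in_range[OF t] l CB B_pos by simp
      then have "0 < (2 * C - B) * t + A + 2 * \<beta> - \<gamma>" using \<beta>\<gamma> param_pos by linarith
      ultimately show ?thesis unfolding dissipation_def F_def by simp
    qed
    have "\<forall>\<^sub>F n in sequentially. x (n + 2) \<in> {l..u}"
    proof -
      have "\<forall>\<^sub>F n in sequentially. I - \<epsilon> / 2 < x (n + 2)"
        using sequentially_offset[OF lo[of "I - \<epsilon> / 2"], of 2] \<epsilon>(1) by simp
      then show ?thesis
        using ev sequentially_offset[OF ev, of 1]
      proof eventually_elim
        case (elim n)
        then show ?case
          unfolding rec[of n]
          using f_ge_if_slope\<^sub>2[of "x (n + 1)" "x n"] f_le_if_slope\<^sub>1[of "x n" "x (n + 1)"] nonneg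
            B_pos C_pos
          by (auto simp: l_def u_def pos_divide_le_eq pos_le_divide_eq mult.commute)
      qed
    qed
    then show "\<forall>\<^sub>F n in sequentially. x n \<in> {l..u}"
      using eventually_sequentially_seg[of "\<lambda>n. x n \<in> {l..u}" 2] by simp
  qed
qed

lemma eventually_affine_neg:
  assumes lo: "\<And>c. c < I \<Longrightarrow> \<forall>\<^sub>F n in sequentially. c < x n"
    and "a + b * I < 0" "b \<le> 0"
  shows "\<forall>\<^sub>F n in sequentially. a + b * x n < 0"
proof (cases "b = 0")
  case True
  with assms show ?thesis by simp
next
  case False
  with assms have b: "b < 0" by simp
  have iff: "- a / b < t \<longleftrightarrow> a + b * t < 0" for t
    using neg_divide_less_eq[OF b, of "- a" t] by (auto simp: mult.commute)
  have "- a / b < I" using assms(2) by (simp only: iff)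
  from lo[OF this] show ?thesis by (simp only: iff)
qed

text \<open>
  Only the limit inferior enters: in each case the slope, as a function of the term, moves away from 0
  to the right of \<open>I\<close>, or is constant.
\<close>

lemma eventually_slope:
  assumes lo: "\<And>c. c < I \<Longrightarrow> \<forall>\<^sub>F n in sequentially. c < x n"
  shows "slope\<^sub>1 I < 0 \<Longrightarrow> \<gamma> * B - \<beta> * C \<ge> 0 \<Longrightarrow> \<forall>\<^sub>F n in sequentially. slope\<^sub>1 (x n) < 0"
    and "slope\<^sub>2 I > 0 \<Longrightarrow> \<gamma> * B - \<beta> * C \<ge> 0 \<Longrightarrow> \<forall>\<^sub>F n in sequentially. slope\<^sub>2 (x n) > 0"
    and "slope\<^sub>1 I > 0 \<Longrightarrow> \<gamma> * B - \<beta> * C \<le> 0 \<Longrightarrow> \<forall>\<^sub>F n in sequentially. slope\<^sub>1 (x n) > 0"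
    and "slope\<^sub>2 I < 0 \<Longrightarrow> \<gamma> * B - \<beta> * C \<le> 0 \<Longrightarrow> \<forall>\<^sub>F n in sequentially. slope\<^sub>2 (x n) < 0"
proof -
  note ev = eventually_affine_neg[of I, OF lo]
  let ?a = "\<beta> * A - B * \<alpha>" and ?b = "\<gamma> * A - C * \<alpha>" and ?d = "\<gamma> * B - \<beta> * C"
  show "slope\<^sub>1 I < 0 \<Longrightarrow> ?d \<ge> 0 \<Longrightarrow> \<forall>\<^sub>F n in sequentially. slope\<^sub>1 (x n) < 0"
    using ev[of ?a "- ?d"] by (simp add: slope\<^sub>1_def algebra_simps)
  show "slope\<^sub>2 I > 0 \<Longrightarrow> ?d \<ge> 0 \<Longrightarrow> \<forall>\<^sub>F n in sequentially. slope\<^sub>2 (x n) > 0"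
    using ev[of "- ?b" "- ?d"] by (simp add: slope\<^sub>2_def algebra_simps)
  show "slope\<^sub>1 I > 0 \<Longrightarrow> ?d \<le> 0 \<Longrightarrow> \<forall>\<^sub>F n in sequentially. slope\<^sub>1 (x n) > 0"
    using ev[of "- ?a" "?d"] by (simp add: slope\<^sub>1_def algebra_simps)
  show "slope\<^sub>2 I < 0 \<Longrightarrow> ?d \<le> 0 \<Longrightarrow> \<forall>\<^sub>F n in sequentially. slope\<^sub>2 (x n) < 0"
    using ev[of "?b" "?d"] by (simp add: slope\<^sub>2_def algebra_simps)
qed

text \<open>
  The sign of \<open>\<kappa>\<close> orders the slopes on \<open>{I..S}\<close>, and together with the relation between the values of the
  slopes at 0 it fixes the direction of monotonicity in one of the two variables. In that variable the
  extremal values \<open>S\<close> and \<open>I\<close> move to an end of \<open>{I..S}\<close> at once; in the other one, the sign of the remaining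
  slope at the ends decides.
\<close>

lemma converges: "tends_to_equilibrium_or_two_cycle x"
proof -
  define \<kappa> where "\<kappa> = \<gamma> * B - \<beta> * C"
  obtain S r where hi: "\<And>c. c > S \<Longrightarrow> \<forall>\<^sub>F n in sequentially. x n < c"
    and r: "strict_mono r" "(\<lambda>k. x (r k)) \<longlonglongrightarrow> S"
    using bounded_seq_limsup[OF bounded] by blast
  obtain I r' where lo: "\<And>c. c < I \<Longrightarrow> \<forall>\<^sub>F n in sequentially. c < x n"
    and r': "strict_mono r'" "(\<lambda>k. x (r' k)) \<longlonglongrightarrow> I"
    using bounded_seq_liminf[OF bounded] by blast
  have "I \<le> S"
    using eventual_bounds_of_subseq_limit(2)[OF lo hi filterlim_subseq[OF r'(1)] r'(2)] by simp
  have "0 \<le> I" by (rule LIMSEQ_le_const[OF r'(2)]) (use nonneg in auto)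
  obtain u v where uv: "u \<in> {I..S}" "v \<in> {I..S}" "S = f u v"
    using limit_point_is_image[OF bounded nonneg rec continuous_on_f r lo hi] by blast
  obtain u' v' where uv': "u' \<in> {I..S}" "v' \<in> {I..S}" "I = f u' v'"
    using limit_point_is_image[OF bounded nonneg rec continuous_on_f r' lo hi] by blast
  have nn: "u \<ge> 0" "v \<ge> 0" "u' \<ge> 0" "v' \<ge> 0" using uv uv' \<open>0 \<le> I\<close> by auto
  have "0 < I" using uv'(3) f_pos[OF nn(3,4)] by simp
  show ?thesis
  proof (cases "I = S")
    case True
    have "x \<longlonglongrightarrow> I"
      by (rule order_tendstoI) (use lo hi True in auto)
    then show ?thesis
      using converges_if_parity_subsequences_converge[of 0 I I]
        LIMSEQ_subseq_LIMSEQ[of x I "\<lambda>k. 2 * k"] LIMSEQ_subseq_LIMSEQ[of x I "\<lambda>k. 1 + 2 * k"]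
      by (simp add: o_def strict_mono_def)
  next
    case False
    with \<open>I \<le> S\<close> have "I < S" by simp
    note IS = \<open>0 \<le> I\<close> \<open>I < S\<close>
    have pos: "I \<ge> 0" "S \<ge> 0" using IS by auto
    have slope\<^sub>1_eq: "slope\<^sub>1 w = slope\<^sub>1 I - \<kappa> * (w - I)" for w
      by (simp add: slope\<^sub>1_def \<kappa>_def algebra_simps)
    have slope\<^sub>2_eq: "slope\<^sub>2 w = slope\<^sub>2 I + \<kappa> * (w - I)" for w
      by (simp add: slope\<^sub>2_def \<kappa>_def algebra_simps)
    have slope\<^sub>1_0: "slope\<^sub>1 w = slope\<^sub>1 0 - \<kappa> * w" and slope\<^sub>2_0: "slope\<^sub>2 w = slope\<^sub>2 0 + \<kappa> * w" for w
      by (simp_all add: slope\<^sub>1_def slope\<^sub>2_def \<kappa>_def)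
    have rel: "C * slope\<^sub>1 0 + A * \<kappa> = B * slope\<^sub>2 0"
      using slope_relation by (simp add: slope\<^sub>1_def slope\<^sub>2_def \<kappa>_def)
    have up\<^sub>1: "f w t \<le> f S t" "f I t \<le> f w t" if "slope\<^sub>1 t \<ge> 0" "w \<in> {I..S}" "t \<ge> 0" for w t
      using that pos by (auto intro!: f_mono\<^sub>1 mult_nonneg_nonneg)
    have dn\<^sub>1: "f w t \<le> f I t" "f S t \<le> f w t" if "slope\<^sub>1 t \<le> 0" "w \<in> {I..S}" "t \<ge> 0" for w t
      using that pos by (auto intro!: f_mono\<^sub>1 mult_nonpos_nonpos)
    have up\<^sub>2: "f t w \<le> f t S" "f t I \<le> f t w" if "slope\<^sub>2 t \<ge> 0" "w \<in> {I..S}" "t \<ge> 0" for w t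
      using that pos by (auto intro!: f_mono\<^sub>2 mult_nonneg_nonneg)
    have dn\<^sub>2: "f t w \<le> f t I" "f t S \<le> f t w" if "slope\<^sub>2 t \<le> 0" "w \<in> {I..S}" "t \<ge> 0" for w t
      using that pos by (auto intro!: f_mono\<^sub>2 mult_nonpos_nonpos)
    \<comment> \<open>The names say in which argument, and in which direction, \<open>f\<close> is monotone everywhere.\<close>
    consider (inc2) "\<kappa> \<ge> 0" "slope\<^sub>2 0 \<ge> 0" | (dec1) "\<kappa> \<ge> 0" "slope\<^sub>2 0 < 0"
      | (inc1) "\<kappa> < 0" "slope\<^sub>1 0 \<ge> 0" | (dec2) "\<kappa> < 0" "slope\<^sub>1 0 < 0"
      by linarith
    then show ?thesis
    proof cases
      case inc2
      have s2: "slope\<^sub>2 w \<ge> 0" if "w \<ge> 0" for w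
        using inc2 that by (subst slope\<^sub>2_0) simp
      have Sf: "S \<le> f u S" using up\<^sub>2(1)[OF s2[OF nn(1)] uv(2) nn(1)] uv(3) by simp
      have If: "f u' I \<le> I" using up\<^sub>2(2)[OF s2[OF nn(3)] uv'(2) nn(3)] uv'(3) by simp
      have ord: "slope\<^sub>1 S \<le> slope\<^sub>1 I" using inc2 IS by (subst slope\<^sub>1_eq) simp
      consider "slope\<^sub>1 S \<ge> 0" | "slope\<^sub>1 S < 0" "slope\<^sub>1 I \<ge> 0" | "slope\<^sub>1 I < 0" by linarith
      then show ?thesis
      proof cases
        case 1
        then have "S \<le> f S S" "f I I \<le> I"
          using Sf If up\<^sub>1(1)[OF _ uv(1) pos(2)] up\<^sub>1(2)[OF _ uv'(1) pos(1)] ord by linarith+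
        then show ?thesis using no_two_fixed_points[OF IS] by blast
      next
        case 2
        then have "S \<le> f I S" "f I I \<le> I"
          using Sf If dn\<^sub>1(1)[OF _ uv(1) pos(2)] up\<^sub>1(2)[OF _ uv'(1) pos(1)] by linarith+
        then show ?thesis using no_low_fixed_high_cross[OF IS] by blast
      next
        case 3
        have "\<forall>\<^sub>F n in sequentially. slope\<^sub>1 (x n) < 0"
          using eventually_slope(1)[OF lo 3] inc2 by (simp add: \<kappa>_def)
        then show ?thesis
          by (intro converges_if_eventually_decreasing_increasing)
            (auto elim!: eventually_mono simp: s2 nonneg)
      qed
    next
      case dec1
      have "B * slope\<^sub>2 0 < 0" "A * \<kappa> \<ge> 0" using dec1 param_pos by (simp_all add: mult_less_0_iff)
      then have "C * slope\<^sub>1 0 < 0" using rel by linarith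
      then have "slope\<^sub>1 0 < 0" using C_pos by (simp add: mult_less_0_iff)
      then have s1: "slope\<^sub>1 w \<le> 0" if "w \<ge> 0" for w
        using dec1 that by (subst slope\<^sub>1_0) (smt (verit) mult_nonneg_nonneg)
      have Sf: "S \<le> f I v" using dn\<^sub>1(1)[OF s1[OF nn(2)] uv(1) nn(2)] uv(3) by simp
      have If: "f S v' \<le> I" using dn\<^sub>1(2)[OF s1[OF nn(4)] uv'(1) nn(4)] uv'(3) by simp
      consider "slope\<^sub>2 I \<le> 0" | "slope\<^sub>2 I > 0" by linarith
      then show ?thesis
      proof cases
        case 1
        then have "S \<le> f I I" using Sf dn\<^sub>2(1)[OF 1 uv(2) pos(1)] by linarith
        moreover have "f S S \<le> I \<or> f S I \<le> I"
          using If up\<^sub>2(2)[OF _ uv'(2) pos(2)] dn\<^sub>2(2)[OF _ uv'(2) pos(2)]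
          by (meson linear order_trans)
        ultimately show ?thesis using no_high_from_low[OF IS] by blast
      next
        case 2
        have "\<forall>\<^sub>F n in sequentially. slope\<^sub>2 (x n) > 0"
          using eventually_slope(2)[OF lo 2] dec1 by (simp add: \<kappa>_def)
        then show ?thesis
          by (intro converges_if_eventually_decreasing_increasing)
            (auto elim!: eventually_mono simp: s1 nonneg)
      qed
    next
      case inc1
      have s1: "slope\<^sub>1 w \<ge> 0" if "w \<ge> 0" for w
        using inc1 that by (subst slope\<^sub>1_0) (smt (verit) mult_nonpos_nonneg)
      have Sf: "S \<le> f S v" using up\<^sub>1(1)[OF s1[OF nn(2)] uv(1) nn(2)] uv(3) by simp
      have If: "f I v' \<le> I" using up\<^sub>1(2)[OF s1[OF nn(4)] uv'(1) nn(4)] uv'(3) by simp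
      have ord: "slope\<^sub>2 w \<le> slope\<^sub>2 I" if "w \<ge> I" for w
        using inc1 that by (subst slope\<^sub>2_eq) (simp add: mult_nonpos_nonneg)
      consider "slope\<^sub>2 S \<ge> 0" | "slope\<^sub>2 S < 0" "slope\<^sub>2 I \<ge> 0" | "slope\<^sub>2 I < 0" by linarith
      then show ?thesis
      proof cases
        case 1
        then have "S \<le> f S S" "f I I \<le> I"
          using Sf If up\<^sub>2(1)[OF _ uv(2) pos(2)] up\<^sub>2(2)[OF _ uv'(2) pos(1)] ord[of S] IS by linarith+
        then show ?thesis using no_two_fixed_points[OF IS] by blast
      next
        case 2
        then have "S \<le> f S I" "f I I \<le> I"
          using Sf If dn\<^sub>2(1)[OF _ uv(2) pos(2)] up\<^sub>2(2)[OF _ uv'(2) pos(1)] by linarith+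
        then show ?thesis using no_low_fixed_high_cross'[OF IS] by blast
      next
        case 3
        have s2: "slope\<^sub>2 w \<le> 0" if "w \<ge> I" for w using ord[OF that] 3 by simp
        show ?thesis
        proof (rule converges_if_increasing_decreasing[OF \<open>0 < I\<close> \<open>I < S\<close> _ _ _ _ lo])
          show "S \<le> f S I" using Sf dn\<^sub>2(1)[OF s2 uv(2) pos(2)] IS by simp
          show "f I S \<le> I" using If dn\<^sub>2(2)[OF s2 uv'(2) pos(1)] by simp
          show "\<gamma> \<le> C * I" using f_ge_if_slope\<^sub>2[OF s2 nn(3,4)] uv' by simp
          show "B * S \<le> \<beta>" using f_le_if_slope\<^sub>1[OF s1[OF nn(2)] nn(1,2)] uv by simp
          have "\<forall>\<^sub>F n in sequentially. slope\<^sub>2 (x n) < 0"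
            using eventually_slope(4)[OF lo 3] inc1 by (simp add: \<kappa>_def)
          then show "\<forall>\<^sub>F n in sequentially. slope\<^sub>1 (x n) \<ge> 0 \<and> slope\<^sub>2 (x n) \<le> 0"
            by (auto elim!: eventually_mono simp: s1 nonneg)
        qed
      qed
    next
      case dec2
      have "C * slope\<^sub>1 0 < 0" "A * \<kappa> < 0" using dec2 param_pos by (simp_all add: mult_less_0_iff)
      then have "B * slope\<^sub>2 0 < 0" using rel by linarith
      then have "slope\<^sub>2 0 < 0" using B_pos by (simp add: mult_less_0_iff)
      then have s2: "slope\<^sub>2 w \<le> 0" if "w \<ge> 0" for w
        using dec2 that by (subst slope\<^sub>2_0) (smt (verit) mult_nonpos_nonneg)
      have Sf: "S \<le> f u I" using dn\<^sub>2(1)[OF s2[OF nn(1)] uv(2) nn(1)] uv(3) by simp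
      have If: "f u' S \<le> I" using dn\<^sub>2(2)[OF s2[OF nn(3)] uv'(2) nn(3)] uv'(3) by simp
      have ord: "slope\<^sub>1 w \<ge> slope\<^sub>1 I" if "w \<ge> I" for w
        using dec2 that by (subst slope\<^sub>1_eq) (simp add: mult_nonpos_nonneg)
      consider "slope\<^sub>1 I \<le> 0" | "slope\<^sub>1 I > 0" by linarith
      then show ?thesis
      proof cases
        case 1
        then have "S \<le> f I I" using Sf dn\<^sub>1(1)[OF 1 uv(1) pos(1)] by linarith
        moreover have "f S S \<le> I \<or> f I S \<le> I"
          using If up\<^sub>1(2)[OF _ uv'(1) pos(2)] dn\<^sub>1(2)[OF _ uv'(1) pos(2)]
          by (meson linear order_trans)
        ultimately show ?thesis using no_high_from_low[OF IS] by blast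
      next
        case 2
        have s1: "slope\<^sub>1 w \<ge> 0" if "w \<ge> I" for w using ord[OF that] 2 by simp
        show ?thesis
        proof (rule converges_if_increasing_decreasing[OF \<open>0 < I\<close> \<open>I < S\<close> _ _ _ _ lo])
          show "S \<le> f S I" using Sf up\<^sub>1(1)[OF s1 uv(1) pos(1)] by simp
          show "f I S \<le> I" using If up\<^sub>1(2)[OF s1 uv'(1) pos(2)] IS by simp
          show "\<gamma> \<le> C * I" using f_ge_if_slope\<^sub>2[OF s2[OF nn(3)] nn(3,4)] uv' by simp
          show "B * S \<le> \<beta>" using f_le_if_slope\<^sub>1[OF s1 nn(1,2)] uv by simp
          have "\<forall>\<^sub>F n in sequentially. slope\<^sub>1 (x n) > 0"
            using eventually_slope(3)[OF lo 2] dec2 by (simp add: \<kappa>_def)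
          then show "\<forall>\<^sub>F n in sequentially. slope\<^sub>1 (x n) \<ge> 0 \<and> slope\<^sub>2 (x n) \<le> 0"
            by (auto elim!: eventually_mono simp: s2 nonneg)
        qed
      qed
    qed
  qed
qed

end

theorem theorem1:
  fixes \<alpha> \<beta> \<gamma> A B C :: real
  assumes "\<alpha> > 0" "\<beta> > 0" "\<gamma> > 0" "A > 0" "B > 0" "C > 0"
  defines "f \<equiv> rational_map \<alpha> \<beta> \<gamma> A B C"
  shows "(\<exists>!e. e > 0 \<and> is_equilibrium f e) \<and>
    (\<forall>x. is_solution f x \<longrightarrow>
       (\<exists>e. e > 0 \<and> is_equilibrium f e \<and> x \<longlonglongrightarrow> e) \<or>
       (\<exists>p. is_prime_period_two f p \<and> (\<lambda>n. x n - p n) \<longlonglongrightarrow> 0))"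
proof -
  interpret rational_recursion \<alpha> \<beta> \<gamma> A B C
    using assms by unfold_locales auto
  have "\<exists>!e. e > 0 \<and> is_equilibrium f e"
    unfolding f_def using equilibrium_exists equilibrium_unique by blast
  moreover have "(\<exists>e. e > 0 \<and> is_equilibrium f e \<and> x \<longlonglongrightarrow> e) \<or>
       (\<exists>p. is_prime_period_two f p \<and> (\<lambda>n. x n - p n) \<longlonglongrightarrow> 0)" if "is_solution f x" for x
  proof -
    interpret solution \<alpha> \<beta> \<gamma> A B C x
      using that by unfold_locales (simp add: f_def)
    show ?thesis using converges unfolding tends_to_equilibrium_or_two_cycle_def f_def .
  qed
  ultimately show ?thesis by blast
qed

end
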